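(* If there exists a polynomial-time algorithm for the problem $\mathrm{AMCCR}_k$ (for general $k\ge 2$, i.e. with $k$ part of the input), then there exists a polynomial-time algorithm for the problem PARTITION.
   Context: Setting of $\mathrm{AMCCR}_k$. Let $k\ge 2$ be an integer and $\beta_1\ge\cdots\ge\beta_k\ge 0$. For each $i\in I=\{1,\ldots,k\}$ let $\alpha_i\ge 1$ be defined by $\alpha_i^2=1+2\beta_i$. Put $$\mathcal{T}_f^k=\{(\xi_1,\ldots,\xi_k)\in[-\beta_1,\beta_1]\times\cdots\times[-\beta_k,\beta_k] : \xi_1+\cdots+\xi_k=0\},\qquad G(\xi_1,\ldots,\xi_k)=\frac1k\sum_{i=1}^k\sqrt{\alpha_i^2+\xi_i^2}.$$ Problem $\mathrm{AMCCR}_k$: given $\beta_1\ge\cdots\ge\beta_k\ge 0$ (rational numbers, encoded in binary), find a pair of index sets $J_+,J_-\subseteq I$ such that for some maximizer $\vec\xi^*=(\xi_1^*,\ldots,\xi_k^* )$ of $G$ over $\mathcal{T}_f^k$ the following hold: (1) $J_+\cap J_-=\emptyset$ and $|J_+|+|J_-|=k-1$; (2) $\xi_i^*=\beta_i$ for each $i\in J_+$; (3) $\xi_i^*=-\beta_i$ for each $i\in J_-$; (4) for the unique index $h\in I\setminus(J_+\cup J_-)$, $\sum_{i\in J_-}\beta_i-\sum_{i\in J_+}\beta_i=\xi_h^*\in[-\beta_h,\beta_h]$. Problem PARTITION: given positive integers $a_1,\ldots,a_k$ (encoded in binary, repetitions allowed), decide whether or not there exists $J\subseteq I=\{1,\ldots,k\}$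 such that $\sum_{i\in J}a_i=\sum_{i\in I\setminus J}a_i$. *)

theory Defs
  imports Complex_Main "HOL-Library.FuncSet" "HOL-Computational_Algebra.Polynomial"
begin

section \<open>Deterministic multi-tape Turing machines\<close>

text \<open>
  Tapes are infinite in both directions and are described relative to the head, which is always at
  position 0: moving the head to the right shifts the contents to the left.  Tape symbols and states
  are natural numbers below the bounds \<open>syms\<close> and \<open>states\<close>, hence finite in number.  The start state
  is 0 (if \<open>states\<close> is 0, the machine halts immediately), and the number \<open>states\<close> itself serves as
  the halting state.  \<open>delta q ss\<close> yields the successor state and, for each tape, the symbol to be
  written and the subsequent head movement, where \<open>ss\<close> lists the symbols under the heads.
\<close>

datatype move = Move_Left | Stay | Move_Right

record machine =
  tapes :: nat
  syms :: nat
  states :: nat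
  delta :: "nat \<Rightarrow> nat list \<Rightarrow> nat \<times> (nat \<times> move) list"

abbreviation (input) blank :: nat where "blank \<equiv> 0"
abbreviation (input) bit0 :: nat where "bit0 \<equiv> 1"
abbreviation (input) bit1 :: nat where "bit1 \<equiv> 2"
abbreviation (input) comma :: nat where "comma \<equiv> 3"
abbreviation (input) slash :: nat where "slash \<equiv> 4"

text \<open>Every machine has the five symbols above, and may have more.\<close>

definition turing_machine :: "machine \<Rightarrow> bool" where
  "turing_machine M \<longleftrightarrow>
     1 \<le> tapes M \<and> 5 \<le> syms M \<and>
     (\<forall>q < states M. \<forall>ss. length ss = tapes M \<and> set ss \<subseteq> {..<syms M} \<longrightarrow>
        (case delta M q ss of (q', as) \<Rightarrow>
           q' \<le> states M \<and> length as = tapes M \<and> (\<forall>(s, m) \<in> set as. s < syms M)))"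

type_synonym tape = "int \<Rightarrow> nat"
type_synonym config = "nat \<times> tape list"

fun offset :: "move \<Rightarrow> int" where
  "offset Move_Left = - 1"
| "offset Stay = 0"
| "offset Move_Right = 1"

fun act :: "nat \<times> move \<Rightarrow> tape \<Rightarrow> tape" where
  "act (s, m) t = (\<lambda>i. (t(0 := s)) (i + offset m))"

fun step :: "machine \<Rightarrow> config \<Rightarrow> config" where
  "step M (q, ts) =
     (if q < states M
      then case delta M q (map (\<lambda>t. t 0) ts) of (q', as) \<Rightarrow> (q', map2 act as ts)
      else (q, ts))"

definition tape_of :: "nat list \<Rightarrow> tape" where
  "tape_of w = (\<lambda>i. if 0 \<le> i \<and> i < int (length w) then w ! nat i else blank)"

definition init :: "machine \<Rightarrow> nat list \<Rightarrow> config" where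
  "init M w = (0, tape_of w # replicate (tapes M - 1) (tape_of []))"

text \<open>
  The output is the word on the first tape that begins under the head and extends to the right up to
  the first blank; the remaining tape contents are irrelevant.
\<close>

definition output_on :: "tape \<Rightarrow> nat list \<Rightarrow> bool" where
  "output_on t y \<longleftrightarrow>
     blank \<notin> set y \<and> (\<forall>j < length y. t (int j) = y ! j) \<and> t (int (length y)) = blank"

definition halts_within :: "machine \<Rightarrow> nat list \<Rightarrow> nat \<Rightarrow> nat list \<Rightarrow> bool" where
  "halts_within M w T y \<longleftrightarrow>
     (\<exists>n \<le> T. \<exists>ts. (step M ^^ n) (init M w) = (states M, ts) \<and> output_on (hd ts) y)"

section \<open>Polynomial-time algorithms\<close>

text \<open>
  A computational problem is given by its set of instances, an encoding of instances as words, the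
  relation between instances and admissible answers, and an encoding of answers (which may depend on
  the instance).  An algorithm has to produce one admissible answer for each instance; its behaviour
  on words that do not encode an instance is irrelevant.
\<close>

definition poly_time_solvable ::
  "'i set \<Rightarrow> ('i \<Rightarrow> nat list) \<Rightarrow> ('i \<Rightarrow> 'o \<Rightarrow> bool) \<Rightarrow> ('i \<Rightarrow> 'o \<Rightarrow> nat list) \<Rightarrow> bool" where
  "poly_time_solvable Inst enc_in Sol enc_out \<longleftrightarrow>
     (\<exists>M. \<exists>p :: nat poly. turing_machine M \<and>
        (\<forall>x \<in> Inst. \<exists>y. Sol x y \<and>
           halts_within M (enc_in x) (poly p (length (enc_in x))) (enc_out x y)))"

text \<open>Binary representation, least significant bit first; 0 is represented by the empty word.\<close>

fun bin :: "nat \<Rightarrow> nat list" where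
  "bin n = (if n = 0 then [] else (if even n then bit0 else bit1) # bin (n div 2))"

declare bin.simps [simp del]

text \<open>Only used for nonnegative rationals, represented as fractions in lowest terms.\<close>

definition enc_rat :: "rat \<Rightarrow> nat list" where
  "enc_rat r = (case quotient_of r of (n, d) \<Rightarrow> bin (nat n) @ slash # bin (nat d))"

definition enc_list :: "('a \<Rightarrow> nat list) \<Rightarrow> 'a list \<Rightarrow> nat list" where
  "enc_list enc xs = concat (map (\<lambda>x. enc x @ [comma]) xs)"

definition enc_bool :: "bool \<Rightarrow> nat" where
  "enc_bool b = (if b then bit1 else bit0)"

text \<open>A subset of \<open>{..<k}\<close> is represented by its characteristic vector.\<close>

definition enc_index_set :: "nat \<Rightarrow> nat set \<Rightarrow> nat list" where
  "enc_index_set k J = map (\<lambda>i. enc_bool (i \<in> J)) [0..<k]"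

section \<open>The problem AMCCR\<close>

text \<open>Indices are shifted by one, i.e. the index set \<open>I\<close> is \<open>{..<k}\<close>.\<close>

definition alpha :: "real \<Rightarrow> real" where
  "alpha b = sqrt (1 + 2 * b)"

definition T_f :: "nat \<Rightarrow> (nat \<Rightarrow> real) \<Rightarrow> (nat \<Rightarrow> real) set" where
  "T_f k \<beta> = {\<xi> \<in> (\<Pi>\<^sub>E i\<in>{..<k}. {- \<beta> i..\<beta> i}). (\<Sum>i<k. \<xi> i) = 0}"

definition G :: "nat \<Rightarrow> (nat \<Rightarrow> real) \<Rightarrow> (nat \<Rightarrow> real) \<Rightarrow> real" where
  "G k \<beta> \<xi> = 1 / real k * (\<Sum>i<k. sqrt ((alpha (\<beta> i))\<^sup>2 + (\<xi> i)\<^sup>2))"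

definition maximizer :: "nat \<Rightarrow> (nat \<Rightarrow> real) \<Rightarrow> (nat \<Rightarrow> real) \<Rightarrow> bool" where
  "maximizer k \<beta> \<xi> \<longleftrightarrow> \<xi> \<in> T_f k \<beta> \<and> (\<forall>\<eta> \<in> T_f k \<beta>. G k \<beta> \<eta> \<le> G k \<beta> \<xi>)"

definition AMCCR_instances :: "rat list set" where
  "AMCCR_instances = {bs. 2 \<le> length bs \<and> sorted_wrt (\<ge>) bs \<and> (\<forall>b \<in> set bs. 0 \<le> b)}"

definition AMCCR_solution :: "rat list \<Rightarrow> nat set \<times> nat set \<Rightarrow> bool" where
  "AMCCR_solution bs = (\<lambda>(Jp, Jm).
     let k = length bs; \<beta> = (\<lambda>i. real_of_rat (bs ! i)) in
       Jp \<subseteq> {..<k} \<and> Jm \<subseteq> {..<k} \<and>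
       (\<exists>\<xi>. maximizer k \<beta> \<xi> \<and>
          Jp \<inter> Jm = {} \<and> card Jp + card Jm = k - 1 \<and>
          (\<forall>i \<in> Jp. \<xi> i = \<beta> i) \<and>
          (\<forall>i \<in> Jm. \<xi> i = - \<beta> i) \<and>
          (\<exists>h. {..<k} - (Jp \<union> Jm) = {h} \<and>
             (\<Sum>i\<in>Jm. \<beta> i) - (\<Sum>i\<in>Jp. \<beta> i) = \<xi> h \<and> \<xi> h \<in> {- \<beta> h..\<beta> h})))"

definition enc_AMCCR_answer :: "rat list \<Rightarrow> nat set \<times> nat set \<Rightarrow> nat list" where
  "enc_AMCCR_answer bs = (\<lambda>(Jp, Jm).
     enc_index_set (length bs) Jp @ comma # enc_index_set (length bs) Jm)"

section \<open>The problem PARTITION\<close>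

definition PARTITION_instances :: "nat list set" where
  "PARTITION_instances = {as. \<forall>a \<in> set as. 0 < a}"

definition has_partition :: "nat list \<Rightarrow> bool" where
  "has_partition as \<longleftrightarrow>
     (\<exists>J \<subseteq> {..<length as}. (\<Sum>i\<in>J. as ! i) = (\<Sum>i\<in>{..<length as} - J. as ! i))"

definition PARTITION_solution :: "nat list \<Rightarrow> bool \<Rightarrow> bool" where
  "PARTITION_solution as b \<longleftrightarrow> (b \<longleftrightarrow> has_partition as)"

definition enc_PARTITION_answer :: "nat list \<Rightarrow> bool \<Rightarrow> nat list" where
  "enc_PARTITION_answer as b = [enc_bool b]"

end

theory Submission
  imports Defs
begin

text \<open>
  A partition of \<open>a\<^sub>1, \<dots>, a\<^sub>k\<close> is a choice of signs with \<open>\<Sum> \<plusminus>a\<^sub>i = 0\<close>.  Since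
  \<open>sqrt (1 + 2 * b + x\<^sup>2) \<le> 1 + b\<close> for \<open>\<bar>x\<bar> \<le> b\<close>, with equality iff \<open>\<bar>x\<bar> = b\<close>, the maximizers of
  \<open>G\<close> for \<open>\<beta>\<^sub>i = a\<^sub>i\<close> are exactly such choices whenever one exists.

  AMCCR requires its input to be sorted.  In order to avoid sorting on a Turing machine, each \<open>a\<^sub>i\<close>
  is replaced by a pair \<open>2 ^ n\<^sub>i + a\<^sub>i, 2 ^ n\<^sub>i\<close> with large and decreasing exponents \<open>n\<^sub>i\<close>; one more pair
  \<open>2 ^ n, 2 ^ n\<close> takes care of the requirement of at least two numbers.  In a signed sum that vanishes,
  the two elements of a pair have opposite signs, so the sign of \<open>a\<^sub>i\<close> can be read off even if one of
  them is the exceptional index \<open>h\<close>.  It remains to test whether the resulting signed sum of the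
  \<open>a\<^sub>i\<close> is 0, which is done by binary arithmetic modulo a sufficiently large power of 2.
\<close>

section \<open>Tapes and runs\<close>

definition nth0 :: "nat list \<Rightarrow> nat \<Rightarrow> nat" where
  "nth0 xs i = (if i < length xs then xs ! i else blank)"

abbreviation hd0 :: "nat list \<Rightarrow> nat" where
  "hd0 xs \<equiv> nth0 xs 0"

text \<open>\<open>l\<close> lists the symbols to the left of the head, starting next to the head.\<close>

definition tp :: "nat list \<Rightarrow> nat list \<Rightarrow> tape" where
  "tp l r = (\<lambda>i. if 0 \<le> i then nth0 r (nat i) else nth0 l (nat (- i - 1)))"

lemma nth0_simps [simp]:
  "nth0 [] i = 0" "nth0 (x # xs) 0 = x" "nth0 (x # xs) (Suc i) = nth0 xs i"
  by (auto simp: nth0_def)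

lemma nth0_tl: "nth0 (tl xs) i = nth0 xs (Suc i)"
  by (cases xs) auto

lemma nth0_append_blank [simp]: "nth0 (xs @ [0]) i = nth0 xs i"
  by (auto simp: nth0_def nth_append)

lemma tp_0 [simp]: "tp l r 0 = hd0 r"
  by (simp add: tp_def)

lemma tp_blank_left [simp]: "tp [0] r = tp [] r"
  using nth0_append_blank[of "[]"] by (auto simp: tp_def simp del: nth0_append_blank)

lemma tp_blank_right [simp]: "tp l (r @ [0]) = tp l r"
  by (auto simp: tp_def)

lemma tp_single_blank [simp]: "tp l [0] = tp l []"
  using tp_blank_right[of l "[]"] by simp

lemma tp_hd0_tl [simp]: "tp l (hd0 r # tl r) = tp l r"
proof -
  have "nth0 (hd0 r # tl r) i = nth0 r i" for i
    by (cases i) (auto simp: nth0_tl)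
  then show ?thesis by (auto simp: tp_def)
qed

lemma tape_of_eq_tp: "tape_of w = tp [] w"
  by (rule ext) (auto simp: tape_of_def tp_def nth0_def)

lemma act_keep [simp]: "act (t 0, Stay) t = t"
  by auto

lemma act_keep_tp [simp]: "act (hd0 r, Stay) (tp l r) = tp l r"
  using act_keep[of "tp l r"] by (simp del: act_keep)

lemma act_keep_Nil [simp]: "act (0, Stay) (tp l []) = tp l []"
  using act_keep_tp[of "[]"] by simp

lemma act_stay: "act (s, Stay) (tp l r) = tp l (s # tl r)"
  by (rule ext) (auto simp: tp_def nth0_def nth_Cons' nth_tl)

lemma act_right: "act (s, Move_Right) (tp l r) = tp (s # l) (tl r)"
proof
  fix i :: int
  consider "i \<ge> 0" | "i = -1" | "i < -1" by linarith
  then show "act (s, Move_Right) (tp l r) i = tp (s # l) (tl r) i"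
  proof cases
    case 1
    then have "nat (i + 1) = Suc (nat i)" by simp
    with 1 show ?thesis by (simp add: tp_def nth0_tl)
  next
    case 3
    then have "nat (- i - 1) = Suc (nat (- (i + 1) - 1))" by simp
    with 3 show ?thesis by (simp only: tp_def act.simps) simp
  qed (simp add: tp_def)
qed

lemma act_left: "act (s, Move_Left) (tp l r) = tp (tl l) (hd0 l # s # tl r)"
proof
  fix i :: int
  consider "i > 1" | "i = 1" | "i = 0" | "i < 0" by linarith
  then show "act (s, Move_Left) (tp l r) i = tp (tl l) (hd0 l # s # tl r) i"
  proof cases
    case 1
    then have "nat i = Suc (Suc (nat (i - 2)))" "nat (i - 1) = Suc (nat (i - 2))" by simp_all
    with 1 show ?thesis by (simp add: tp_def nth0_tl)
  next
    case 4
    then have "nat (- i) = Suc (nat (- i - 1))" by simp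
    with 4 show ?thesis by (simp add: tp_def nth0_tl)
  qed (simp_all add: tp_def)
qed

lemmas act_tp = act_stay act_right act_left

declare act.simps [simp del]

text \<open>An upper bound on the number of steps instead of an exact count: phases whose length
  depends on the data then compose by adding their bounds.\<close>

definition runs :: "machine \<Rightarrow> nat \<Rightarrow> config \<Rightarrow> config \<Rightarrow> bool" where
  "runs M t c c' \<longleftrightarrow> (\<exists>n\<le>t. (step M ^^ n) c = c')"

lemma runs_refl [simp]: "runs M t c c"
  unfolding runs_def by (rule exI[of _ 0]) simp

lemma runs_step: "runs M t (step M c) c' \<Longrightarrow> runs M (Suc t) c c'"
  unfolding runs_def by (metis Suc_le_mono comp_apply funpow_Suc_right)

lemma runs_trans:
  assumes "runs M s c c'" and "runs M t c' c''" and "s + t \<le> u"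
  shows "runs M u c c''"
proof -
  obtain m n where "m \<le> s" "(step M ^^ m) c = c'" "n \<le> t" "(step M ^^ n) c' = c''"
    using assms by (auto simp: runs_def)
  with assms(3) show ?thesis
    unfolding runs_def by (intro exI[of _ "n + m"]) (simp add: funpow_add)
qed

lemma runs_mono: "runs M s c c' \<Longrightarrow> s \<le> t \<Longrightarrow> runs M t c c'"
  by (erule runs_trans[OF _ runs_refl[of M 0]]) simp

section \<open>The reduction machine\<close>

text \<open>The flag of \<open>Slash\<close>, \<open>One\<close> and \<open>Comma\<close> tells
  whether the second number of a pair is being written. \<open>Sign\<close> remembers the bit read
  from the first index set; \<open>Acc\<close> remembers the sign of the current number and the
  carry or borrow.\<close>

datatype st =
    Fwd | Back | Item | Slash bool | One bool | Comma bool | Zero | RewA | RewD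
  | Copy | RewC | Next | Sign bool | Acc bool bool | RewB | Check | is_Sim: Sim (sim_state: nat)

text \<open>\<open>Fwd\<close> must receive 0, the start state. The unbounded family
  \<open>Sim\<close> comes last, so that \<open>code (Sim (Suc (states M)))\<close> exceeds the code
  of every working state and can serve as the halting state.\<close>

fun code :: "st \<Rightarrow> nat" where
  "code Fwd = 0"
| "code Back = 1"
| "code Item = 2"
| "code (Slash f) = 3 + of_bool f"
| "code (One f) = 5 + of_bool f"
| "code (Comma f) = 7 + of_bool f"
| "code Zero = 9"
| "code RewA = 10"
| "code RewD = 11"
| "code Copy = 12"
| "code RewC = 13"
| "code Next = 14"
| "code (Sign f) = 15 + of_bool f"
| "code (Acc f g) = 17 + 2 * of_bool f + of_bool g"
| "code RewB = 21"
| "code Check = 22"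
| "code (Sim q) = 23 + q"

lemma inj_code: "inj code"
proof (rule injI)
  fix x y assume "code x = code y"
  then show "x = y"
    by (cases x; cases y) (auto simp: of_bool_def split: if_splits)
qed

lemma inv_code [simp]: "inv code (code q) = q"
  by (rule inv_f_f[OF inj_code])

definition dig :: "bool \<Rightarrow> nat" where
  "dig x = (if x then bit1 else bit0)"

text \<open>With sign \<open>s\<close> the carry, without it the borrow.\<close>

definition carry :: "bool \<Rightarrow> bool \<Rightarrow> bool \<Rightarrow> bool \<Rightarrow> bool" where
  "carry s b x k = (if s then (b \<and> x) \<or> (b \<and> k) \<or> (x \<and> k) else (\<not> b \<and> (x \<or> k)) \<or> (x \<and> k))"

text \<open>
  The four tapes hold the PARTITION instance, a ruler consisting of zero digits that later serves as
  the accumulator, a copy of the first index set, and the input or output of the AMCCR algorithm,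
  whose other tapes follow.  The parameter \<open>h\<close> is chosen as \<open>Suc (states M)\<close>, so that \<open>Sim h\<close> is the
  halting state, while \<open>Sim (states M)\<close> signals that the simulation of \<open>M\<close> has ended.
\<close>

fun trans :: "nat \<Rightarrow> st \<Rightarrow> nat \<Rightarrow> nat \<Rightarrow> nat \<Rightarrow> nat \<Rightarrow>
    st \<times> (nat \<times> move) \<times> (nat \<times> move) \<times> (nat \<times> move) \<times> (nat \<times> move)" where
  "trans h Fwd a b c d =
     (if a \<noteq> 0 then (Fwd, (a, Move_Right), (1, Move_Left), (c, Stay), (d, Stay))
      else (Back, (a, Move_Left), (b, Stay), (c, Stay), (d, Stay)))"
| "trans h Back a b c d =
     (if a \<noteq> 0 then (Back, (a, Move_Left), (1, Move_Left), (c, Stay), (d, Stay))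
      else (Item, (a, Move_Right), (b, Move_Right), (c, Stay), (d, Stay)))"
| "trans h Item a b c d =
     (if a = 1 \<or> a = 2 then (Item, (a, Move_Right), (b, Move_Right), (c, Stay), (a, Move_Right))
      else if b \<noteq> 0 then (Item, (a, Stay), (b, Move_Right), (c, Stay), (1, Move_Right))
      else (Slash False, (a, Stay), (b, Move_Left), (c, Stay), (2, Move_Right)))"
| "trans h (Slash f) a b c d = (One f, (a, Stay), (b, Stay), (c, Stay), (4, Move_Right))"
| "trans h (One f) a b c d = (Comma f, (a, Stay), (b, Stay), (c, Stay), (2, Move_Right))"
| "trans h (Comma f) a b c d =
     (if \<not> f then (Zero, (a, Stay), (b, Stay), (c, Stay), (3, Move_Right))
      else if a \<noteq> 0 then (Item, (a, Move_Right), (0, Move_Right), (c, Stay), (3, Move_Right))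
      else (RewA, (a, Move_Left), (b, Stay), (c, Stay), (3, Stay)))"
| "trans h Zero a b c d =
     (if b \<noteq> 0 then (Zero, (a, Stay), (b, Move_Left), (c, Stay), (1, Move_Right))
      else (Slash True, (a, Stay), (b, Move_Right), (c, Stay), (2, Move_Right)))"
| "trans h RewA a b c d =
     (if a \<noteq> 0 then (RewA, (a, Move_Left), (b, Stay), (c, Stay), (d, Stay))
      else (RewD, (a, Move_Right), (b, Stay), (c, Stay), (d, Stay)))"
| "trans h RewD a b c d =
     (if d \<noteq> 0 then (RewD, (a, Stay), (b, Stay), (c, Stay), (d, Move_Left))
      else (Sim 0, (a, Stay), (b, Stay), (c, Stay), (d, Move_Right)))"
| "trans h Copy a b c d =
     (if d \<noteq> 3 then (Copy, (a, Stay), (b, Stay), (d, Move_Right), (d, Move_Right))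
      else (RewC, (a, Stay), (b, Stay), (c, Move_Left), (d, Move_Right)))"
| "trans h RewC a b c d =
     (if c \<noteq> 0 then (RewC, (a, Stay), (b, Stay), (c, Move_Left), (d, Stay))
      else (Next, (a, Stay), (b, Stay), (c, Move_Right), (d, Stay)))"
| "trans h Next a b c d =
     (if a \<noteq> 0 then (Sign (c = 2), (a, Stay), (b, Stay), (c, Move_Right), (d, Move_Right))
      else (Check, (a, Stay), (b, Stay), (c, Stay), (d, Stay)))"
| "trans h (Sign p) a b c d =
     (Acc (p \<or> d = 2) False, (a, Stay), (b, Stay), (c, Move_Right), (d, Move_Right))"
| "trans h (Acc s k) a b c d =
     (if b \<noteq> 0 then
        (Acc s (carry s (b = 2) (a = 2) k),
         (a, if a = 1 \<or> a = 2 then Move_Right else Stay),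
         (dig ((b = 2) \<noteq> ((a = 2) \<noteq> k)), Move_Right), (c, Stay), (d, Stay))
      else (RewB, (a, Stay), (b, Move_Left), (c, Stay), (d, Stay)))"
| "trans h RewB a b c d =
     (if b \<noteq> 0 then (RewB, (a, Stay), (b, Move_Left), (c, Stay), (d, Stay))
      else (Next, (a, Move_Right), (b, Move_Right), (c, Stay), (d, Stay)))"
| "trans h Check a b c d =
     (if b = 1 then (Check, (a, Stay), (b, Move_Right), (c, Stay), (d, Stay))
      else (Sim h, (if b = 0 then 2 else 1, Stay), (b, Stay), (c, Stay), (d, Stay)))"
| "trans h (Sim q) a b c d = (Copy, (a, Stay), (b, Stay), (c, Stay), (d, Stay))"

definition red_delta :: "machine \<Rightarrow> nat \<Rightarrow> nat list \<Rightarrow> nat \<times> (nat \<times> move) list" where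
  "red_delta M n ss =
     (let ds = drop 3 ss; q = inv code n in
      if q \<in> Sim ` {..<states M}
      then case delta M (sim_state q) ds of
        (q', as) \<Rightarrow> (code (Sim q'), map (\<lambda>s. (s, Stay)) (take 3 ss) @ as)
      else case trans (Suc (states M)) q (ss ! 0) (ss ! 1) (ss ! 2) (hd ds) of
        (q', x, y, z, u) \<Rightarrow> (code q', x # y # z # u # map (\<lambda>s. (s, Stay)) (tl ds)))"

definition red :: "machine \<Rightarrow> machine" where
  "red M = \<lparr>tapes = tapes M + 3, syms = syms M, states = code (Sim (Suc (states M))),
     delta = red_delta M\<rparr>"

lemma red_simps [simp]:
  "tapes (red M) = tapes M + 3" "syms (red M) = syms M"
  "states (red M) = code (Sim (Suc (states M)))" "delta (red M) = red_delta M"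
  by (simp_all add: red_def)

lemma trans_wf:
  assumes "trans (Suc h) q a b c d = (q', x, y, z, u)" and "5 \<le> n" and "{a, b, c, d} \<subseteq> {..<n}"
  shows "code q' \<le> code (Sim (Suc h)) \<and> fst x < n \<and> fst y < n \<and> fst z < n \<and> fst u < n"
  using assms by (cases q) (auto simp: dig_def of_bool_def split: if_splits)

lemma turing_machine_red:
  assumes M: "turing_machine M"
  shows "turing_machine (red M)"
proof -
  have "case red_delta M q ss of (q', as) \<Rightarrow> q' \<le> states (red M) \<and>
      length as = tapes (red M) \<and> (\<forall>(s, m) \<in> set as. s < syms (red M))"
    if ss: "length ss = tapes (red M)" "set ss \<subseteq> {..<syms (red M)}" for q ss
  proof -
    obtain a b c ds where *: "ss = a # b # c # ds" "length ds = tapes M"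
      using ss(1) by (auto simp: length_Suc_conv numeral_3_eq_3)
    obtain d es where ds: "ds = d # es"
      using * M by (cases ds) (auto simp: turing_machine_def)
    show ?thesis
    proof (cases "inv code q \<in> Sim ` {..<states M}")
      case True
      obtain j where j: "inv code q = Sim j" "j < states M" using True by auto
      moreover have "case delta M j ds of (q', as) \<Rightarrow>
         q' \<le> states M \<and> length as = tapes M \<and> (\<forall>(s, m) \<in> set as. s < syms M)"
        using M j * ss by (auto simp: turing_machine_def)
      ultimately show ?thesis
        using * ss by (auto simp: red_delta_def Let_def split: prod.splits)
    next
      case False
      then show ?thesis
        using trans_wf[of "states M" "inv code q" a b c d _ _ _ _ _ "syms M"] M * ds ss
        by (auto simp: red_delta_def Let_def turing_machine_def split: prod.splits)
    qed
  qed
  then show ?thesis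
    using M by (auto simp: turing_machine_def)
qed


section \<open>Single steps of the reduction machine and simulation of \<open>M\<close>\<close>

declare code.simps [simp del] step.simps [simp del]

abbreviation conf :: "st \<Rightarrow> tape \<Rightarrow> tape \<Rightarrow> tape \<Rightarrow> tape \<Rightarrow> tape list \<Rightarrow> config" where
  "conf q A B C D Es \<equiv> (code q, A # B # C # D # Es)"

lemma map2_act_keep: "map2 act (map (\<lambda>s. (s, Stay)) (map (\<lambda>t. t 0) ts)) ts = ts"
  by (induction ts) auto

lemma step_red:
  assumes "\<not> is_Sim q"
  shows "step (red M) (conf q A B C D Es) =
    (case trans (Suc (states M)) q (A 0) (B 0) (C 0) (D 0) of
      (q', x, y, z, u) \<Rightarrow> conf q' (act x A) (act y B) (act z C) (act u D) Es)"
proof -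
  have "code q < states (red M)" using assms by (cases q) (auto simp: code.simps of_bool_def)
  moreover have "q \<notin> Sim ` {..<states M}" using assms by auto
  ultimately show ?thesis
    using map2_act_keep[of Es]
    by (auto simp: step.simps red_delta_def Let_def numeral_3_eq_3 split: prod.splits)
qed

lemma step_red_Sim:
  assumes "q < states M"
  shows "step (red M) (code (Sim q), A # B # C # ts) =
    (case step M (q, ts) of (q', ts') \<Rightarrow> (code (Sim q'), A # B # C # ts'))"
proof -
  have "code (Sim q) < states (red M)" using assms by (simp add: code.simps)
  then show ?thesis
    using assms
    by (auto simp: step.simps red_delta_def Let_def numeral_3_eq_3 split: prod.splits)
qed

lemma step_red_Sim_halt:
  "step (red M) (conf (Sim (states M)) A B C D Es) = conf Copy A B C D Es"
proof -
  have "code (Sim (states M)) < states (red M)" by (simp add: code.simps)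
  then show ?thesis
    using map2_act_keep[of Es]
    by (auto simp: step.simps red_delta_def Let_def numeral_3_eq_3 split: prod.splits)
qed

lemma step_halted: "\<not> q < states M \<Longrightarrow> (step M ^^ n) (q, ts) = (q, ts)"
  by (induction n) (auto simp: step.simps)

text \<open>\<open>M\<close> may idle in its halting state for part of the \<open>n\<close> steps,
  whereas the reduction machine would move on to \<open>Copy\<close>. This is why at most
  \<open>n\<close> steps are claimed: idling is matched by zero steps.\<close>

lemma runs_Sim:
  "(step M ^^ n) (q, ts) = (states M, ts') \<Longrightarrow>
   runs (red M) n (code (Sim q), A # B # C # ts) (code (Sim (states M)), A # B # C # ts')"
proof (induction n arbitrary: q ts)
  case 0
  then show ?case by simp
next
  case (Suc n)
  show ?case
  proof (cases "q < states M")
    case True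
    obtain q1 ts1 where 1: "step M (q, ts) = (q1, ts1)" by fastforce
    then have "(step M ^^ n) (q1, ts1) = (states M, ts')"
      using Suc.prems by (simp add: funpow_Suc_right del: funpow.simps)
    from Suc.IH[OF this] show ?thesis
      by (intro runs_step) (simp add: step_red_Sim[OF True] 1)
  next
    case False
    from step_halted[OF False, of "Suc n" ts] Suc.prems show ?thesis by simp
  qed
qed

text \<open>An invariant guaranteeing that no tape is lost during the simulation. The bound on the
  symbols has to be carried along, because \<open>turing_machine\<close> constrains
  \<open>delta\<close> on legal symbols only.\<close>

definition tapes_ok :: "machine \<Rightarrow> tape list \<Rightarrow> bool" where
  "tapes_ok M ts \<longleftrightarrow> length ts = tapes M \<and> (\<forall>t\<in>set ts. \<forall>i. t i < syms M)"

lemma act_less: "fst x < n \<Longrightarrow> (\<And>i. t i < n) \<Longrightarrow> act x t i < n"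
  by (cases x) (simp add: act.simps)

lemma tapes_ok_step:
  assumes M: "turing_machine M" and ok: "tapes_ok M ts"
  shows "tapes_ok M (snd (step M (q, ts)))"
proof (cases "q < states M")
  case True
  let ?ss = "map (\<lambda>t. t 0) ts"
  obtain q' as where d: "delta M q ?ss = (q', as)" by (rule prod.exhaust)
  have "length ?ss = tapes M" using ok by (simp add: tapes_ok_def)
  moreover have "set ?ss \<subseteq> {..<syms M}" using ok by (auto simp: tapes_ok_def)
  ultimately have "case delta M q ?ss of (q', as) \<Rightarrow>
      q' \<le> states M \<and> length as = tapes M \<and> (\<forall>(s, m) \<in> set as. s < syms M)"
    using M True unfolding turing_machine_def by simp
  then have as: "length as = tapes M" "\<forall>(s, m) \<in> set as. s < syms M" using d by simp_all
  have "t i < syms M" if t: "t \<in> set (map2 act as ts)" for t i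
  proof -
    obtain x u where xu: "(x, u) \<in> set (zip as ts)" "t = act x u"
      using t unfolding set_map by (elim imageE) (auto simp: case_prod_beta)
    have "fst x < syms M" using as(2) set_zip_leftD[OF xu(1)] by (cases x) auto
    moreover have "u j < syms M" for j
      using ok set_zip_rightD[OF xu(1)] by (simp add: tapes_ok_def)
    ultimately show ?thesis unfolding xu(2) by (rule act_less)
  qed
  moreover have "length (map2 act as ts) = tapes M" using as ok by (simp add: tapes_ok_def)
  moreover have "snd (step M (q, ts)) = map2 act as ts" using True d by (simp add: step.simps)
  ultimately show ?thesis unfolding tapes_ok_def by simp
next
  case False
  then show ?thesis using ok by (simp add: step.simps)
qed

lemma tapes_ok_run:
  assumes "turing_machine M" and "tapes_ok M ts"
  shows "tapes_ok M (snd ((step M ^^ n) (q, ts)))"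
proof (induction n)
  case (Suc n)
  obtain q' ts' where "(step M ^^ n) (q, ts) = (q', ts')" by fastforce
  with Suc show ?case using tapes_ok_step[OF assms(1), of ts' q'] by simp
qed (use assms in simp)

text \<open>
  Starting one cell to the left of \<open>r\<close>, i.e. on the last symbol of \<open>rev l\<close> or the blank before it.
\<close>

lemma runs_RewA:
  "0 \<notin> set l \<Longrightarrow> runs (red M) (length l + 1)
     (conf RewA (tp (tl l) (hd0 l # r)) B C D Es) (conf RewD (tp [] (rev l @ r)) B C D Es)"
proof (induction l arbitrary: r)
  case Nil
  show ?case
    by simp (rule runs_step, simp add: step_red act_tp)
next
  case (Cons x l)
  show ?case
    by (simp, rule runs_step) (use Cons in \<open>simp add: step_red act_tp\<close>)
qed

lemma runs_RewD:
  "0 \<notin> set l \<Longrightarrow> runs (red M) (length l + 1)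
     (conf RewD A B C (tp (tl l) (hd0 l # r)) Es) (conf (Sim 0) A B C (tp [] (rev l @ r)) Es)"
proof (induction l arbitrary: r)
  case Nil
  show ?case
    by simp (rule runs_step, simp add: step_red act_tp)
next
  case (Cons x l)
  show ?case
    by (simp, rule runs_step) (use Cons in \<open>simp add: step_red act_tp\<close>)
qed

lemma runs_RewC:
  "0 \<notin> set l \<Longrightarrow> runs (red M) (length l + 1)
     (conf RewC A B (tp (tl l) (hd0 l # r)) D Es) (conf Next A B (tp [] (rev l @ r)) D Es)"
proof (induction l arbitrary: r)
  case Nil
  show ?case
    by simp (rule runs_step, simp add: step_red act_tp)
next
  case (Cons x l)
  show ?case
    by (simp, rule runs_step) (use Cons in \<open>simp add: step_red act_tp\<close>)
qed

lemma runs_RewB: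
  "0 \<notin> set l \<Longrightarrow> runs (red M) (length l + 1)
     (conf RewB (tp al (a # ar)) (tp (tl l) (hd0 l # r)) C D Es)
     (conf Next (tp (a # al) ar) (tp [] (rev l @ r)) C D Es)"
proof (induction l arbitrary: r)
  case Nil
  show ?case
    by simp (rule runs_step, simp add: step_red act_tp)
next
  case (Cons x l)
  show ?case
    by (simp, rule runs_step) (use Cons in \<open>simp add: step_red act_tp\<close>)
qed

section \<open>Construction of the ruler\<close>

lemma runs_Fwd:
  "0 \<notin> set r \<Longrightarrow> runs (red M) (length r)
     (conf Fwd (tp l r) (tp [] (0 # bs)) C D Es)
     (conf Fwd (tp (rev r @ l) []) (tp [] (0 # replicate (length r) 1 @ bs)) C D Es)"
proof (induction r arbitrary: l bs)
  case (Cons x r)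
  show ?case
    by (simp, rule runs_step)
       (use Cons.prems Cons.IH[of "x # l" "1 # bs"] in
         \<open>auto simp: step_red act_tp replicate_app_Cons_same\<close>)
qed simp

lemma runs_Back:
  "0 \<notin> set l \<Longrightarrow> runs (red M) (length l + 1)
     (conf Back (tp (tl l) (hd0 l # r)) (tp [] (0 # bs)) C D Es)
     (conf Item (tp [] (rev l @ r)) (tp [] (replicate (length l) 1 @ bs)) C D Es)"
proof (induction l arbitrary: r bs)
  case Nil
  show ?case
    by simp (rule runs_step, simp add: step_red act_tp)
next
  case (Cons x l)
  show ?case
    by (simp, rule runs_step)
       (use Cons.prems Cons.IH[of "x # r" "1 # bs"] in
         \<open>auto simp: step_red act_tp replicate_app_Cons_same\<close>)
qed

text \<open>Two passes over the input give two cells per input symbol. The ruler later loses one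
  cell per number, and at least \<open>length w\<close> cells remain, enough for the exponents and
  for the accumulator.\<close>

lemma runs_ruler:
  assumes "0 \<notin> set w"
  shows "runs (red M) (2 * length w + 2)
     (conf Fwd (tp [] w) (tp [] []) C D Es)
     (conf Item (tp [] w) (tp [] (replicate (2 * length w) 1)) C D Es)"
proof -
  let ?n = "length w"
  have 1: "runs (red M) ?n (conf Fwd (tp [] w) (tp [] []) C D Es)
     (conf Fwd (tp (rev w) []) (tp [] (0 # replicate ?n 1)) C D Es)"
    using runs_Fwd[of w M "[]" "[]" C D Es] assms by simp
  have 2: "runs (red M) 1 (conf Fwd (tp (rev w) []) (tp [] (0 # replicate ?n 1)) C D Es)
     (conf Back (tp (tl (rev w)) (hd0 (rev w) # [0])) (tp [] (0 # replicate ?n 1)) C D Es)"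
    unfolding One_nat_def by (rule runs_step) (simp add: step_red act_tp)
  have 3: "runs (red M) (?n + 1)
     (conf Back (tp (tl (rev w)) (hd0 (rev w) # [0])) (tp [] (0 # replicate ?n 1)) C D Es)
     (conf Item (tp [] w) (tp [] (replicate (2 * ?n) 1)) C D Es)"
    using runs_Back[of "rev w" M "[0]" "replicate ?n 1"] assms
    by (simp add: replicate_add[symmetric] mult_2)
  show ?thesis
    by (rule runs_trans[OF 1 runs_trans[OF 2 3 order.refl]]) simp
qed

section \<open>Writing the AMCCR instance\<close>

lemma runs_Item_bits:
  "set xs \<subseteq> {1, 2} \<Longrightarrow> runs (red M) (length xs)
     (conf Item (tp l (xs @ z)) (tp bl (replicate (length xs) 1 @ bs)) C (tp dl []) Es)
     (conf Item (tp (rev xs @ l) z) (tp (replicate (length xs) 1 @ bl) bs) C (tp (rev xs @ dl) []) Es)"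
proof (induction xs arbitrary: l bl dl)
  case (Cons x xs)
  show ?case
    by (simp, rule runs_step)
       (use Cons.prems Cons.IH[of "x # l" "1 # bl" "x # dl"] in
         \<open>auto simp: step_red act_tp replicate_app_Cons_same\<close>)
qed simp

lemma runs_Item_pad:
  "hd0 z \<notin> {1, 2} \<Longrightarrow> runs (red M) n
     (conf Item (tp l z) (tp bl (replicate n 1)) C (tp dl []) Es)
     (conf Item (tp l z) (tp (replicate n 1 @ bl) []) C (tp (replicate n 1 @ dl) []) Es)"
proof (induction n arbitrary: bl dl)
  case (Suc n)
  show ?case
    by (rule runs_step)
       (use Suc.prems Suc.IH[of "1 # bl" "1 # dl"] in
         \<open>auto simp: step_red act_tp replicate_app_Cons_same\<close>)
qed simp

lemma runs_Zero:
  "runs (red M) (n + 1)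
     (conf Zero A (tp (tl (replicate n 1)) (hd0 (replicate n 1) # r)) C (tp dl []) Es)
     (conf (Slash True) A (tp [] (replicate n 1 @ r)) C (tp (2 # replicate n 1 @ dl) []) Es)"
proof (induction n arbitrary: r dl)
  case 0
  show ?case
    by simp (rule runs_step, simp add: step_red act_tp)
next
  case (Suc n)
  show ?case
    by (simp, rule runs_step)
       (use Suc.IH[of "1 # r" "1 # dl"] in \<open>auto simp: step_red act_tp replicate_app_Cons_same\<close>)
qed

text \<open>A pair of fractions with denominator 1. Padding to length \<open>n\<close> and appending
  a one adds \<open>2 ^ n\<close> to the number without any carry; the second number is
  \<open>2 ^ n\<close> itself.\<close>

definition item :: "nat \<Rightarrow> nat list \<Rightarrow> nat list" where
  "item n xs = xs @ replicate (n - length xs) bit0 @ [bit1, slash, bit1, comma]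
     @ replicate n bit0 @ [bit1, slash, bit1, comma]"

text \<open>The run stops just before the last comma, hence the \<open>tl\<close>: the step that
  writes this comma also decides from the first tape whether another number follows.\<close>

lemma runs_Item:
  assumes xs: "set xs \<subseteq> {1, 2}" "length xs \<le> n" and z: "hd0 z \<notin> {1, 2}"
  shows "runs (red M) (2 * n + 7)
     (conf Item (tp l (xs @ z)) (tp [] (replicate n 1)) C (tp dl []) Es)
     (conf (Comma True) (tp (rev xs @ l) z) (tp [] (replicate n 1)) C
        (tp (tl (rev (item n xs)) @ dl) []) Es)"
proof -
  let ?m = "length xs"
  let ?A = "tp (rev xs @ l) z"
  let ?dl = "replicate (n - ?m) 1 @ rev xs @ dl"
  have rep: "replicate n 1 = replicate ?m 1 @ replicate (n - ?m) (1::nat)"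
    using xs by (simp add: replicate_add[symmetric])
  have rep': "replicate n 1 = replicate (n - ?m) 1 @ replicate ?m (1::nat)"
    using xs by (simp add: replicate_add[symmetric])
  have 1: "runs (red M) ?m (conf Item (tp l (xs @ z)) (tp [] (replicate n 1)) C (tp dl []) Es)
     (conf Item ?A (tp (replicate ?m 1) (replicate (n - ?m) 1)) C (tp (rev xs @ dl) []) Es)"
    using runs_Item_bits[OF xs(1), of M l z "[]" "replicate (n - ?m) 1"] rep by simp
  have 2: "runs (red M) (n - ?m)
     (conf Item ?A (tp (replicate ?m 1) (replicate (n - ?m) 1)) C (tp (rev xs @ dl) []) Es)
     (conf Item ?A (tp (replicate n 1) []) C (tp ?dl []) Es)"
    using runs_Item_pad[OF z, of M "n - ?m"] rep' by simp
  \<comment> \<open>The ruler is exhausted: the four steps write the leading one, the slash, the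
    denominator 1 and the comma of the first number.\<close>
  have 3: "runs (red M) (Suc (Suc (Suc (Suc 0))))
     (conf Item ?A (tp (replicate n 1) []) C (tp ?dl []) Es)
     (conf Zero ?A (tp (tl (replicate n 1)) (hd0 (replicate n 1) # [0])) C
        (tp ([3, 2, 4, 2] @ ?dl) []) Es)"
    using z by (intro runs_step) (simp add: step_red act_tp del: tl_replicate)
  have 4: "runs (red M) (n + 1)
     (conf Zero ?A (tp (tl (replicate n 1)) (hd0 (replicate n 1) # [0])) C
        (tp ([3, 2, 4, 2] @ ?dl) []) Es)
     (conf (Slash True) ?A (tp [] (replicate n 1)) C
        (tp ([2] @ replicate n 1 @ [3, 2, 4, 2] @ ?dl) []) Es)"
    using runs_Zero[of M n ?A "[0]"] by simp
  have 5: "runs (red M) (Suc (Suc 0))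
     (conf (Slash True) ?A (tp [] (replicate n 1)) C
        (tp ([2] @ replicate n 1 @ [3, 2, 4, 2] @ ?dl) []) Es)
     (conf (Comma True) ?A (tp [] (replicate n 1)) C
        (tp ([2, 4, 2] @ replicate n 1 @ [3, 2, 4, 2] @ ?dl) []) Es)"
    by (intro runs_step) (simp add: step_red act_tp del: tl_replicate)
  have 6: "tl (rev (item n xs)) @ dl = [2, 4, 2] @ replicate n 1 @ [3, 2, 4, 2] @ ?dl"
    by (simp add: item_def)
  show ?thesis unfolding 6
    by (rule runs_trans[OF 1 runs_trans[OF 2 runs_trans[OF 3 runs_trans[OF 4 5
        order.refl] order.refl] order.refl]]) (use xs in simp)
qed

text \<open>Beyond the last number the machine finds a blank and treats it as one more number with
  empty representation, which yields the extra pair in the base case.\<close>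

fun out :: "nat \<Rightarrow> nat list list \<Rightarrow> nat list" where
  "out n [] = item n []"
| "out n (xs # xss) = item n xs @ out (n - 1) xss"


lemma length_item: "length xs \<le> n \<Longrightarrow> length (item n xs) = 2 * n + 8"
  by (simp add: item_def)

lemma item_snoc: "3 # tl (rev (item n xs)) = rev (item n xs)"
  by (simp add: item_def)

lemma out_snoc: "3 # tl (rev (out n xss)) = rev (out n xss)"
proof (induction n xss rule: out.induct)
  case (2 n xs xss)
  then show ?case by (metis out.simps(2) rev_append append_Cons list.sel(3))
qed (simp add: item_snoc)

definition commas :: "nat list list \<Rightarrow> nat list" where
  "commas xss = concat (map (\<lambda>xs. xs @ [comma]) xss)"

lemma commas_simps [simp]: "commas [] = []" "commas (xs # xss) = xs @ comma # commas xss"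
  by (simp_all add: commas_def)

text \<open>Each number costs the ruler one cell while one word fewer remains, so the hypothesis on
  \<open>n\<close> is preserved by the induction. It ensures that every word fits under the current
  ruler.\<close>

lemma runs_Items:
  assumes "\<forall>xs\<in>set xss. set xs \<subseteq> {1, 2} \<and> length xs + length xss \<le> n"
    and "L = rev (commas xss) @ l"
  shows "runs (red M) ((length xss + 1) * (2 * n + 8))
     (conf Item (tp l (commas xss)) (tp [] (replicate n 1)) C (tp dl []) Es)
     (conf RewA (tp (tl L) (hd0 L # [0])) (tp [] (replicate (n - length xss) 1)) C
        (tp (tl (rev (out n xss)) @ dl) [3]) Es)"
  using assms
proof (induction xss arbitrary: n l dl L)
  case Nil
  have 1: "runs (red M) (2 * n + 7)
     (conf Item (tp l []) (tp [] (replicate n 1)) C (tp dl []) Es)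
     (conf (Comma True) (tp l []) (tp [] (replicate n 1)) C (tp (tl (rev (item n [])) @ dl) []) Es)"
    using runs_Item[of "[]" n "[]"] by simp
  have 2: "runs (red M) (Suc 0)
     (conf (Comma True) (tp l []) (tp [] (replicate n 1)) C (tp (tl (rev (item n [])) @ dl) []) Es)
     (conf RewA (tp (tl l) (hd0 l # [0])) (tp [] (replicate n 1)) C
        (tp (tl (rev (item n [])) @ dl) [3]) Es)"
    by (rule runs_step) (simp add: step_red act_tp del: tl_replicate)
  show ?case using runs_trans[OF 1 2] Nil by simp
next
  case (Cons xs xss)
  let ?A = "tp (3 # rev xs @ l) (commas xss)"
  have 1: "runs (red M) (2 * n + 7)
     (conf Item (tp l (xs @ 3 # commas xss)) (tp [] (replicate n 1)) C (tp dl []) Es)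
     (conf (Comma True) (tp (rev xs @ l) (3 # commas xss)) (tp [] (replicate n 1)) C
        (tp (tl (rev (item n xs)) @ dl) []) Es)"
    using Cons.prems by (intro runs_Item) auto
  have 2: "runs (red M) (Suc 0)
     (conf (Comma True) (tp (rev xs @ l) (3 # commas xss)) (tp [] (replicate n 1)) C
        (tp (tl (rev (item n xs)) @ dl) []) Es)
     (conf Item ?A (tp [] (replicate (n - 1) 1)) C (tp (rev (item n xs) @ dl) []) Es)"
    by (rule runs_step) (simp add: step_red act_tp item_snoc flip: append_Cons)
  have 3: "runs (red M) ((length xss + 1) * (2 * (n - 1) + 8))
     (conf Item ?A (tp [] (replicate (n - 1) 1)) C (tp (rev (item n xs) @ dl) []) Es)
     (conf RewA (tp (tl L) (hd0 L # [0])) (tp [] (replicate (n - 1 - length xss) 1)) C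
        (tp (tl (rev (out (n - 1) xss)) @ rev (item n xs) @ dl) [3]) Es)"
    using Cons.prems by (intro Cons.IH) auto
  have "tl (rev (out (n - 1) xss)) @ rev (item n xs) = tl (rev (out n (xs # xss)))"
    using out_snoc[of "n - 1" xss] by (metis out.simps(2) rev_append append_Cons list.sel(3))
  then have 4: "tl (rev (out (n - 1) xss)) @ rev (item n xs) @ dl = tl (rev (out n (xs # xss))) @ dl"
    by simp
  have le: "(length xss + 1) * (2 * (n - 1) + 8) \<le> (length xss + 1) * (2 * n + 8)"
    by (intro mult_le_mono) auto
  have 5: "n - 1 - length xss = n - length (xs # xss)" by simp
  show ?case
    using runs_trans[OF 1 runs_trans[OF 2 3 order.refl, unfolded 4 5]] le by simp
qed

lemma set_out: "\<forall>xs\<in>set xss. set xs \<subseteq> {1, 2} \<Longrightarrow> set (out n xss) \<subseteq> {1, 2, 3, 4}"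
  by (induction n xss rule: out.induct) (auto simp: item_def)

lemma set_commas: "\<forall>xs\<in>set xss. set xs \<subseteq> {1, 2} \<Longrightarrow> set (commas xss) \<subseteq> {1, 2, 3}"
  by (auto simp: commas_def)

lemma runs_reduce:
  assumes "\<forall>xs\<in>set xss. set xs \<subseteq> {1, 2} \<and> length xs + length xss \<le> n"
    and w: "w = commas xss" and n: "n = 2 * length w"
  shows "runs (red M) (3 * length w + 4 + (length xss + 1) * (2 * n + 8) + length (out n xss))
     (conf Fwd (tp [] w) (tp [] []) C (tp [] []) Es)
     (conf (Sim 0) (tp [] w) (tp [] (replicate (n - length xss) 1)) C (tp [] (out n xss)) Es)"
proof -
  let ?B = "tp [] (replicate (n - length xss) 1)"
  let ?D = "tp (tl (rev (out n xss))) [3]"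
  have w0: "0 \<notin> set w" using set_commas[of xss] assms by fastforce
  have o0: "0 \<notin> set (out n xss)" using set_out[of xss n] assms by fastforce
  have 1: "runs (red M) (2 * length w + 2)
     (conf Fwd (tp [] w) (tp [] []) C (tp [] []) Es)
     (conf Item (tp [] w) (tp [] (replicate n 1)) C (tp [] []) Es)"
    unfolding n by (rule runs_ruler[OF w0])
  have 2: "runs (red M) ((length xss + 1) * (2 * n + 8))
     (conf Item (tp [] w) (tp [] (replicate n 1)) C (tp [] []) Es)
     (conf RewA (tp (tl (rev w)) (hd0 (rev w) # [0])) ?B C ?D Es)"
    using runs_Items[OF assms(1), of "rev w" "[]" M C "[]" Es] w by simp
  have 3: "runs (red M) (length w + 1)
     (conf RewA (tp (tl (rev w)) (hd0 (rev w) # [0])) ?B C ?D Es) (conf RewD (tp [] w) ?B C ?D Es)"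
    using runs_RewA[of "rev w" M "[0]"] w0 by simp
  \<comment> \<open>The head rests on the final comma; this brings the tape into the form from which
    rewinding starts.\<close>
  have "hd0 (rev (out n xss)) = 3"
    using out_snoc[of n xss] by (metis nth0_simps(2))
  then have "?D = tp (tl (rev (out n xss))) (hd0 (rev (out n xss)) # [])" by simp
  then have 4: "runs (red M) (length (out n xss) + 1)
     (conf RewD (tp [] w) ?B C ?D Es) (conf (Sim 0) (tp [] w) ?B C (tp [] (out n xss)) Es)"
    using runs_RewD[of "rev (out n xss)" M "tp [] w" ?B C "[]" Es] o0 by simp
  show ?thesis
    by (rule runs_trans[OF 1 runs_trans[OF 2 runs_trans[OF 3 4 order.refl] order.refl]]) simp
qed

section \<open>Reading the answer of \<open>M\<close> and accumulating the signed sum\<close>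

fun reads :: "tape \<Rightarrow> nat list \<Rightarrow> bool" where
  "reads t [] \<longleftrightarrow> True"
| "reads t (x # xs) \<longleftrightarrow> t 0 = x \<and> reads (\<lambda>i. t (i + 1)) xs"

lemma readsI: "(\<And>j. j < length xs \<Longrightarrow> t (int j) = xs ! j) \<Longrightarrow> reads t xs"
proof (induction xs arbitrary: t)
  case (Cons x xs)
  have "t (int j + 1) = xs ! j" if "j < length xs" for j
    using Cons.prems[of "Suc j"] that by (simp add: add.commute)
  then show ?case using Cons.IH[of "\<lambda>i. t (i + 1)"] Cons.prems[of 0] by simp
qed simp

lemma act_skip: "act (t 0, Move_Right) t = (\<lambda>i. t (i + 1))"
  by (auto simp: act.simps)

text \<open>\<open>M\<close> may leave arbitrary symbols outside its output. The tape is therefore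
  described by \<open>reads\<close>, which fixes just the cells still to be read, and not by
  \<open>tp\<close>.\<close>

lemma runs_Copy:
  assumes "3 \<notin> set xs" and "reads D (xs @ 3 # ys)" and "L = rev xs @ cl"
  shows "\<exists>D'. reads D' ys \<and> runs (red M) (length xs + 1)
     (conf Copy A B (tp cl []) D Es) (conf RewC A B (tp (tl L) (hd0 L # [0])) D' Es)"
  using assms
proof (induction xs arbitrary: D cl L)
  case Nil
  then have "runs (red M) (Suc 0) (conf Copy A B (tp cl []) D Es)
      (conf RewC A B (tp (tl L) (hd0 L # [0])) (\<lambda>i. D (i + 1)) Es)"
    using act_skip[of D] by (intro runs_step) (simp add: step_red act_tp)
  with Nil show ?case by (intro exI[of _ "\<lambda>i. D (i + 1)"]) simp
next
  case (Cons x xs)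
  have x: "x \<noteq> 3" using Cons.prems by auto
  obtain D' where D': "reads D' ys" "runs (red M) (length xs + 1)
     (conf Copy A B (tp (x # cl) []) (\<lambda>i. D (i + 1)) Es)
     (conf RewC A B (tp (tl L) (hd0 L # [0])) D' Es)"
    using Cons.IH[of "\<lambda>i. D (i + 1)" L "x # cl"] Cons.prems by auto
  have "runs (red M) (length (x # xs) + 1)
     (conf Copy A B (tp cl []) D Es) (conf RewC A B (tp (tl L) (hd0 L # [0])) D' Es)"
    by (simp, rule runs_step)
       (use Cons.prems D'(2) act_skip[of D] x in \<open>simp add: step_red act_tp\<close>)
  with D'(1) show ?case by blast
qed

text \<open>Ripple-carry addition or subtraction. The width of the accumulator is kept and the last
  carry dropped, so the computation is modulo a power of 2.\<close>

fun acc :: "bool \<Rightarrow> bool \<Rightarrow> nat list \<Rightarrow> nat list \<Rightarrow> nat list" where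
  "acc s k xs [] = []"
| "acc s k xs (b # bs) = dig ((b = 2) \<noteq> ((hd0 xs = 2) \<noteq> k))
     # acc s (carry s (b = 2) (hd0 xs = 2) k) (tl xs) bs"

lemma length_acc [simp]: "length (acc s k xs bs) = length bs"
  by (induction bs arbitrary: k xs) auto

lemma set_acc: "set (acc s k xs bs) \<subseteq> {1, 2}"
  by (induction bs arbitrary: k xs) (auto simp: dig_def)

text \<open>Once \<open>xs\<close> is used up, the first head rests on a symbol that is not a bit.
  It counts as digit 0 while the carry travels through the remaining accumulator cells.\<close>

lemma runs_Acc:
  assumes "set xs \<subseteq> {1, 2}" and "length xs \<le> length bs" and "0 \<notin> set bs" and "hd0 z \<notin> {1, 2}"
    and "L = rev (acc s k xs bs) @ bl"
  shows "runs (red M) (length bs + 1)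
     (conf (Acc s k) (tp l (xs @ z)) (tp bl bs) C D Es)
     (conf RewB (tp (rev xs @ l) z) (tp (tl L) (hd0 L # [0])) C D Es)"
  using assms
proof (induction bs arbitrary: xs k l bl L)
  case Nil
  then show ?case by simp (rule runs_step, simp add: step_red act_tp)
next
  case (Cons b bs)
  show ?case
  proof (cases xs)
    case Nil
    have "runs (red M) (length bs + 1)
     (conf (Acc s (carry s (b = 2) False k)) (tp l z) (tp (dig ((b = 2) \<noteq> k) # bl) bs) C D Es)
     (conf RewB (tp l z) (tp (tl L) (hd0 L # [0])) C D Es)"
      using Cons.prems Cons.IH[of "[]" L "carry s (b = 2) False k" "dig ((b = 2) \<noteq> k) # bl" l] Nil
      by simp
    note IH' = this
    show ?thesis
      by (simp, rule runs_step) (use IH' Nil Cons.prems in \<open>simp add: step_red act_right\<close>)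
  next
    case (Cons x xs')
    let ?k = "carry s (b = 2) (x = 2) k" and ?d = "dig ((b = 2) \<noteq> ((x = 2) \<noteq> k))"
    have "runs (red M) (length bs + 1)
     (conf (Acc s ?k) (tp (x # l) (xs' @ z)) (tp (?d # bl) bs) C D Es)
     (conf RewB (tp (rev xs' @ x # l) z) (tp (tl L) (hd0 L # [0])) C D Es)"
      using Cons.prems Cons.IH[of xs' L ?k "?d # bl" "x # l"] Cons by simp
    note IH' = this
    show ?thesis
      by (simp, rule runs_step) (use IH' Cons Cons.prems in \<open>auto simp: step_red act_right\<close>)
  qed
qed


definition accs :: "nat list \<Rightarrow> bool list \<Rightarrow> nat list list \<Rightarrow> nat list" where
  "accs bs ss xss = fold (\<lambda>(s, xs) bs. acc s False xs bs) (zip ss xss) bs"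

lemma accs_simps [simp]:
  "accs bs [] xss = bs" "accs bs ss [] = bs"
  "accs bs (s # ss) (xs # xss) = accs (acc s False xs bs) ss xss"
  by (simp_all add: accs_def)

lemma length_accs [simp]: "length (accs bs ss xss) = length bs"
proof (induction xss arbitrary: bs ss)
  case (Cons xs xss)
  then show ?case by (cases ss) auto
qed simp

lemma set_accs: "set bs \<subseteq> {1, 2} \<Longrightarrow> set (accs bs ss xss) \<subseteq> {1, 2}"
proof (induction xss arbitrary: bs ss)
  case (Cons xs xss)
  then show ?case using set_acc by (cases ss) auto
qed simp

text \<open>\<open>ps\<close> and \<open>ms\<close> are the characteristic vectors of the two index
  sets. The first element of a pair being positive or the second being negative both mean that the
  number has positive sign; asking for either copes with one missing index.\<close>

definition signs :: "nat \<Rightarrow> nat list \<Rightarrow> nat list \<Rightarrow> bool list" where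
  "signs k ps ms = map (\<lambda>i. ps ! (2 * i) = bit1 \<or> ms ! (2 * i + 1) = bit1) [0..<k]"

lemma signs_simps [simp]:
  "signs 0 ps ms = []"
  "signs (Suc k) (p # p' # ps) (m # m' # ms) = (p = 2 \<or> m' = 2) # signs k ps ms"
  by (simp_all add: signs_def map_upt_Suc del: upt_Suc)

lemma runs_Next:
  assumes "\<forall>xs\<in>set xss. set xs \<subseteq> {1, 2} \<and> length xs \<le> length bs" and "0 \<notin> set bs"
    and "2 * length xss \<le> length ps" and "2 * length xss \<le> length ms" and "reads D ms"
  shows "\<exists>C' D'. runs (red M) (length xss * (2 * length bs + 4) + 1)
     (conf Next (tp l (commas xss)) (tp [] bs) (tp cl ps) D Es)
     (conf Check (tp (rev (commas xss) @ l) []) (tp [] (accs bs (signs (length xss) ps ms) xss))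
        C' D' Es)"
  using assms
proof (induction xss arbitrary: l bs cl ps ms D)
  case Nil
  have "runs (red M) (Suc 0)
     (conf Next (tp l []) (tp [] bs) (tp cl ps) D Es)
     (conf Check (tp l []) (tp [] bs) (tp cl ps) D Es)"
    by (rule runs_step) (simp add: step_red)
  then show ?case by auto
next
  case (Cons xs xss)
  obtain p p' ps' where ps: "ps = p # p' # ps'"
    using Cons.prems(3) by (cases ps; cases "tl ps") auto
  obtain m m' ms' where ms: "ms = m # m' # ms'"
    using Cons.prems(4) by (cases ms; cases "tl ms") auto
  let ?s = "p = 2 \<or> m' = 2"
  let ?z = "3 # commas xss" and ?C = "tp (p' # p # cl) ps'" and ?D = "\<lambda>i. D (i + 2)"
  let ?bs = "acc ?s False xs bs"
  have D: "D 0 = m" "D 1 = m'" "reads ?D ms'"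
    using Cons.prems(5) ms by (simp_all add: add.commute)
  have D1: "act (m, Move_Right) D = (\<lambda>i. D (i + 1))" using act_skip[of D] D by simp
  have D2: "act (m', Move_Right) (\<lambda>i. D (i + 1)) = ?D"
    using act_skip[of "\<lambda>i. D (i + 1)"] D by (simp add: add.commute)
  have xs: "set xs \<subseteq> {1, 2}" "length xs \<le> length bs" using Cons.prems by auto
  \<comment> \<open>Even an empty \<open>xs\<close> leaves its comma under the head, so a blank
    appears only after the last number.\<close>
  have nz: "hd0 (xs @ ?z) \<noteq> 0" using xs(1) by (cases xs) auto
  have 1: "runs (red M) (Suc (Suc 0))
     (conf Next (tp l (xs @ ?z)) (tp [] bs) (tp cl ps) D Es)
     (conf (Acc ?s False) (tp l (xs @ ?z)) (tp [] bs) ?C ?D Es)"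
    using nz D by (intro runs_step) (simp add: step_red act_right ps D1 D2)
  have 2: "runs (red M) (length bs + 1)
     (conf (Acc ?s False) (tp l (xs @ ?z)) (tp [] bs) ?C ?D Es)
     (conf RewB (tp (rev xs @ l) ?z) (tp (tl (rev ?bs)) (hd0 (rev ?bs) # [0])) ?C ?D Es)"
    by (rule runs_Acc) (use xs Cons.prems in simp_all)
  have bs0: "0 \<notin> set ?bs" using set_acc[of ?s False xs bs] by fastforce
  have 3: "runs (red M) (length bs + 1)
     (conf RewB (tp (rev xs @ l) ?z) (tp (tl (rev ?bs)) (hd0 (rev ?bs) # [0])) ?C ?D Es)
     (conf Next (tp (3 # rev xs @ l) (commas xss)) (tp [] ?bs) ?C ?D Es)"
    using runs_RewB[of "rev ?bs" M "rev xs @ l" 3 "commas xss" "[0]" ?C ?D Es] bs0 by simp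
  obtain C' D' where "runs (red M) (length xss * (2 * length ?bs + 4) + 1)
     (conf Next (tp (3 # rev xs @ l) (commas xss)) (tp [] ?bs) ?C ?D Es)
     (conf Check (tp (rev (commas xss) @ 3 # rev xs @ l) [])
       (tp [] (accs ?bs (signs (length xss) ps' ms') xss)) C' D' Es)"
    using Cons.IH[of ?bs ps' ms' ?D "3 # rev xs @ l" "p' # p # cl"] Cons.prems bs0 D ps ms by auto
  then have 4: "runs (red M) (length xss * (2 * length bs + 4) + 1)
     (conf Next (tp (3 # rev xs @ l) (commas xss)) (tp [] ?bs) ?C ?D Es)
     (conf Check (tp (rev (commas (xs # xss)) @ l) [])
       (tp [] (accs bs (signs (length (xs # xss)) ps ms) (xs # xss))) C' D' Es)"
    by (simp add: ps ms)
  have "runs (red M) (length (xs # xss) * (2 * length bs + 4) + 1)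
     (conf Next (tp l (commas (xs # xss))) (tp [] bs) (tp cl ps) D Es)
     (conf Check (tp (rev (commas (xs # xss)) @ l) [])
       (tp [] (accs bs (signs (length (xs # xss)) ps ms) (xs # xss))) C' D' Es)"
    unfolding commas_simps(2)[of xs xss]
    by (rule runs_trans[OF 1 runs_trans[OF 2 runs_trans[OF 3 4[unfolded commas_simps(2)]
      order.refl] order.refl]]) simp
  then show ?case by blast
qed

text \<open>The answer is written on the blank cell behind the instance; the blank to its right ends
  the output.\<close>

lemma runs_Check:
  "set bs \<subseteq> {1, 2} \<Longrightarrow> \<exists>B'. runs (red M) (length bs + 1)
     (conf Check (tp l []) (tp bl bs) C D Es)
     (conf (Sim (Suc (states M))) (tp l [enc_bool (2 \<notin> set bs)]) B' C D Es)"
proof (induction bs arbitrary: bl)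
  case Nil
  have "runs (red M) (Suc 0) (conf Check (tp l []) (tp bl []) C D Es)
     (conf (Sim (Suc (states M))) (tp l [2]) (tp bl []) C D Es)"
    by (rule runs_step) (simp add: step_red act_stay)
  then show ?case by (auto simp: enc_bool_def)
next
  case (Cons b bs)
  show ?case
  proof (cases "b = 1")
    case True
    obtain B' where B': "runs (red M) (length bs + 1) (conf Check (tp l []) (tp (1 # bl) bs) C D Es)
       (conf (Sim (Suc (states M))) (tp l [enc_bool (2 \<notin> set bs)]) B' C D Es)"
      using Cons.IH[of "1 # bl"] Cons.prems by auto
    have "runs (red M) (length (b # bs) + 1) (conf Check (tp l []) (tp bl (b # bs)) C D Es)
       (conf (Sim (Suc (states M))) (tp l [enc_bool (2 \<notin> set (b # bs))]) B' C D Es)"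
      by (simp, rule runs_step) (use True B' in \<open>simp add: step_red act_right\<close>)
    then show ?thesis by blast
  next
    case False
    then have "b = 2" using Cons.prems by auto
    then have "runs (red M) (Suc 0) (conf Check (tp l []) (tp bl (b # bs)) C D Es)
       (conf (Sim (Suc (states M))) (tp l [enc_bool (2 \<notin> set (b # bs))]) (tp bl (2 # bs)) C D Es)"
      by (intro runs_step) (simp add: step_red act_stay enc_bool_def)
    then have "runs (red M) (length (b # bs) + 1) (conf Check (tp l []) (tp bl (b # bs)) C D Es)
       (conf (Sim (Suc (states M))) (tp l [enc_bool (2 \<notin> set (b # bs))]) (tp bl (2 # bs)) C D Es)"
      by (rule runs_mono) simp
    then show ?thesis by blast
  qed
qed

lemma halts_within_red:
  assumes M: "turing_machine M"
    and xss: "\<forall>xs\<in>set xss. set xs \<subseteq> {1, 2} \<and> length xs + length xss \<le> n"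
    and w: "w = commas xss" and n: "n = 2 * length w"
    and run: "halts_within M (out n xss) T (ps @ comma # ms)"
    and ps: "set ps \<subseteq> {1, 2}" "2 * length xss \<le> length ps" "2 * length xss \<le> length ms"
    and T': "3 * length w + (length xss + 1) * (2 * n + 8) + length (out n xss) + T
      + 2 * length ps + length xss * (2 * n + 4) + n + 10 \<le> T'"
  shows "halts_within (red M) w T'
    [enc_bool (2 \<notin> set (accs (replicate (n - length xss) 1) (signs (length xss) ps ms) xss))]"
proof -
  let ?E = "tp [] []" and ?r = "replicate (n - length xss) (1 :: nat)"
  let ?Es = "replicate (tapes M - 1) ?E" and ?v = "out n xss" and ?A = "tp [] w" and ?B = "tp [] ?r"
  let ?bs = "accs ?r (signs (length xss) ps ms) xss"
  have xss': "\<forall>xs\<in>set xss. set xs \<subseteq> {1, 2}" using xss by blast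
  have init_red: "init (red M) w = conf Fwd ?A ?E ?E ?E ?Es"
    using M by (simp add: init_def code.simps tape_of_eq_tp turing_machine_def numeral_3_eq_3
        flip: replicate_Suc)
  have 1: "runs (red M) (3 * length w + 4 + (length xss + 1) * (2 * n + 8) + length ?v)
     (conf Fwd ?A ?E ?E ?E ?Es) (conf (Sim 0) ?A ?B ?E (tp [] ?v) ?Es)"
    by (rule runs_reduce[OF xss w n])
  obtain m ts where m: "m \<le> T" "(step M ^^ m) (init M ?v) = (states M, ts)"
      "output_on (hd ts) (ps @ comma # ms)"
    using run by (auto simp: halts_within_def)
  have init: "init M ?v = (0, tp [] ?v # ?Es)" by (simp add: init_def tape_of_eq_tp)
  \<comment> \<open>The encoded instance uses symbols up to 4, and every machine has at least five
    symbols.\<close>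
  have "tp [] ?v i < syms M" for i
  proof -
    have "nth0 ?v j \<le> 4" for j
      using set_out[OF xss', of n] nth_mem[of j ?v] by (fastforce simp: nth0_def)
    moreover have "5 \<le> syms M" using M by (simp add: turing_machine_def)
    ultimately show ?thesis by (smt (verit) tp_def nth0_simps(1) le_less_trans less_le_trans
        not_less numeral_less_iff semiring_norm zero_le)
  qed
  moreover have "?E i < syms M" for i using M by (simp add: tp_def turing_machine_def)
  ultimately have "tapes_ok M (tp [] ?v # ?Es)"
    using M by (auto simp: tapes_ok_def turing_machine_def)
  from tapes_ok_run[OF M this, of m 0] have "length ts = tapes M"
    using m(2) init by (simp add: tapes_ok_def)
  then obtain D Fs where ts: "ts = D # Fs" using M by (cases ts) (auto simp: turing_machine_def)
  have 2: "runs (red M) T (conf (Sim 0) ?A ?B ?E (tp [] ?v) ?Es) (conf (Sim (states M)) ?A ?B ?E D Fs)"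
    by (rule runs_mono[OF runs_Sim[OF m(2)[unfolded init ts]] m(1)])
  have 3: "runs (red M) (Suc 0) (conf (Sim (states M)) ?A ?B ?E D Fs) (conf Copy ?A ?B ?E D Fs)"
    by (rule runs_step) (simp add: step_red_Sim_halt)
  have "reads D (ps @ comma # ms)"
    by (rule readsI) (use m(3) ts in \<open>simp add: output_on_def\<close>)
  moreover have "3 \<notin> set ps" using ps by auto
  ultimately obtain D' where D': "reads D' ms" and 4: "runs (red M) (length ps + 1)
     (conf Copy ?A ?B ?E D Fs) (conf RewC ?A ?B (tp (tl (rev ps)) (hd0 (rev ps) # [0])) D' Fs)"
    using runs_Copy[of ps D ms "rev ps" "[]" M ?A ?B Fs] by auto
  have "0 \<notin> set ps" using ps by auto
  then have 5: "runs (red M) (length ps + 1)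
     (conf RewC ?A ?B (tp (tl (rev ps)) (hd0 (rev ps) # [0])) D' Fs)
     (conf Next ?A ?B (tp [] ps) D' Fs)"
    using runs_RewC[of "rev ps" M ?A ?B "[0]" D' Fs] by simp
  have "\<forall>xs\<in>set xss. set xs \<subseteq> {1, 2} \<and> length xs \<le> length ?r" using xss by fastforce
  then obtain C1 D1 where 6: "runs (red M) (length xss * (2 * length ?r + 4) + 1)
     (conf Next ?A ?B (tp [] ps) D' Fs) (conf Check (tp (rev w) []) (tp [] ?bs) C1 D1 Fs)"
    using runs_Next[of xss ?r ps ms D' M "[]" "[]" Fs] ps D' w by auto
  have "set ?bs \<subseteq> {1, 2}" by (rule set_accs) auto
  then obtain B1 where 7: "runs (red M) (length ?bs + 1)
     (conf Check (tp (rev w) []) (tp [] ?bs) C1 D1 Fs)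
     (conf (Sim (Suc (states M))) (tp (rev w) [enc_bool (2 \<notin> set ?bs)]) B1 C1 D1 Fs)"
    using runs_Check by blast
  have le: "length xss * (2 * length ?r + 4) \<le> length xss * (2 * n + 4)"
    by (intro mult_le_mono) auto
  have "runs (red M) T' (init (red M) w)
     (conf (Sim (Suc (states M))) (tp (rev w) [enc_bool (2 \<notin> set ?bs)]) B1 C1 D1 Fs)"
    unfolding init_red
    by (rule runs_trans[OF 1 runs_trans[OF 2 runs_trans[OF 3 runs_trans[OF 4 runs_trans[OF 5
        runs_trans[OF 6 7 order.refl] order.refl] order.refl] order.refl] order.refl]])
       (use T' le in \<open>simp only: length_replicate length_accs; linarith\<close>)
  moreover have "output_on (tp (rev w) [enc_bool b]) [enc_bool b]" for b
    by (simp add: output_on_def enc_bool_def tp_def nth0_def)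
  ultimately show ?thesis
    unfolding halts_within_def runs_def by fastforce
qed


section \<open>Arithmetic of the words\<close>

fun num :: "nat list \<Rightarrow> nat" where
  "num [] = 0"
| "num (b # bs) = of_bool (b = bit1) + 2 * num bs"

lemma num_bin [simp]: "num (bin n) = n"
proof (induction n rule: bin.induct)
  case (1 n)
  show ?case
  proof (cases "n = 0")
    case False
    then have "bin n = (if even n then 1 else 2) # bin (n div 2)" by (subst bin.simps) simp
    then show ?thesis using 1[OF False] by (auto elim!: oddE)
  qed (simp add: bin.simps)
qed

lemma num_less: "num bs < 2 ^ length bs"
  by (induction bs) (auto simp: of_bool_def)

lemma num_eq_0_iff: "num bs = 0 \<longleftrightarrow> 2 \<notin> set bs"
  by (induction bs) auto

text \<open>Induction along the digits with an arbitrary incoming carry or borrow; the multiple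
  \<open>q\<close> absorbs the one that leaves the accumulator.\<close>

lemma num_acc:
  "length xs \<le> length bs \<Longrightarrow> \<exists>q. int (num (acc s k xs bs)) =
    int (num bs) + (if s then 1 else -1) * (int (num xs) + of_bool k) + 2 ^ length bs * q"
proof (induction bs arbitrary: xs k)
  case Nil
  \<comment> \<open>Without digits the modulus is 1, and \<open>q\<close> cancels the incoming
    carry.\<close>
  then show ?case by (intro exI[of _ "- (if s then 1 else -1) * of_bool k"]) simp
next
  case (Cons b bs)
  let ?x = "hd0 xs = 2" and ?s = "if s then 1 else -1 :: int"
  let ?k = "carry s (b = 2) ?x k"
  obtain q where q: "int (num (acc s ?k (tl xs) bs)) =
      int (num bs) + ?s * (int (num (tl xs)) + of_bool ?k) + 2 ^ length bs * q"
    using Cons.IH[of "tl xs" ?k] Cons.prems by (metis length_tl list.size(4) le_diff_conv add_Suc_right add_0_right One_nat_def)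
  have xs: "int (num xs) = of_bool ?x + 2 * int (num (tl xs))" by (cases xs) auto
  have dig: "num (dig y # ys) = of_bool y + 2 * num ys" for y ys by (simp add: dig_def)
  \<comment> \<open>The identity of a full adder or subtractor for one digit, checked by cases. The
    step after it lifts this identity to whole words by pure ring arithmetic.\<close>
  have "of_bool ((b = 2) \<noteq> (?x \<noteq> k)) + 2 * (?s * of_bool ?k) =
      of_bool (b = 2) + ?s * (of_bool ?x + of_bool k)"
    by (auto simp: carry_def)
  moreover have "d + 2 * (B + e * (t + c') + P * q) = b' + 2 * B + e * (x + 2 * t + c) + 2 * P * q"
    if "d + 2 * (e * c') = b' + e * (x + c)" for d B e t c' P b' x c :: int
    using that by (simp add: algebra_simps)
  ultimately have "of_bool ((b = 2) \<noteq> (?x \<noteq> k)) + 2 * int (num (acc s ?k (tl xs) bs)) =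
      of_bool (b = 2) + 2 * int (num bs) + ?s * (int (num xs) + of_bool k) + 2 * 2 ^ length bs * q"
    unfolding q xs by blast
  then have "int (num (acc s k xs (b # bs))) =
      int (num (b # bs)) + ?s * (int (num xs) + of_bool k) + 2 ^ length (b # bs) * q"
    unfolding acc.simps dig num.simps(2)[of b bs] by (simp split del: if_split)
  then show ?case ..
qed

section \<open>Signed sums and their values modulo a power of 2\<close>

definition ssum :: "bool list \<Rightarrow> nat list \<Rightarrow> int" where
  "ssum ss as = (\<Sum>(s, a)\<leftarrow>zip ss as. if s then int a else - int a)"

lemma ssum_simps [simp]:
  "ssum [] as = 0" "ssum ss [] = 0"
  "ssum (s # ss) (a # as) = (if s then int a else - int a) + ssum ss as"
  by (simp_all add: ssum_def)

lemma abs_ssum_le: "\<bar>ssum ss as\<bar> \<le> int (sum_list as)"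
proof (induction as arbitrary: ss)
  case (Cons a as)
  show ?case
  proof (cases ss)
    case (Cons s ss')
    then show ?thesis using Cons.IH[of ss'] by auto
  qed simp
qed simp

lemma ssum_eq_sum:
  "length ss = length as \<Longrightarrow> ssum ss as = (\<Sum>i<length as. if ss ! i then int (as ! i) else - int (as ! i))"
  by (simp add: ssum_def sum_list_sum_nth atLeast0LessThan)

lemma num_accs:
  "\<forall>xs\<in>set xss. length xs \<le> length bs \<Longrightarrow>
    \<exists>q. int (num (accs bs ss xss)) = int (num bs) + ssum ss (map num xss) + 2 ^ length bs * q"
proof (induction xss arbitrary: bs ss)
  case Nil
  show ?case by (intro exI[of _ 0]) simp
next
  case (Cons xs xss)
  show ?case
  proof (cases ss)
    case Nil
    then show ?thesis by (intro exI[of _ 0]) simp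
  next
    case (Cons s ss')
    obtain q where q: "int (num (acc s False xs bs)) =
        int (num bs) + (if s then 1 else -1) * int (num xs) + 2 ^ length bs * q"
      using num_acc[of xs bs s False] Cons.prems by auto
    obtain r where r: "int (num (accs (acc s False xs bs) ss' xss)) =
        int (num (acc s False xs bs)) + ssum ss' (map num xss) + 2 ^ length bs * r"
      using Cons.IH[of "acc s False xs bs" ss'] Cons.prems by auto
    show ?thesis
      by (intro exI[of _ "q + r"]) (simp add: Cons q r algebra_simps)
  qed
qed

text \<open>The accumulator is congruent to the signed sum modulo \<open>2 ^ R\<close>, and both are
  smaller than \<open>2 ^ R\<close> in absolute value; hence one vanishes exactly if the other
  does.\<close>

lemma accs_eq_0_iff:
  assumes "\<forall>xs\<in>set xss. length xs \<le> R" and "sum_list (map num xss) < 2 ^ R"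
  shows "2 \<notin> set (accs (replicate R 1) ss xss) \<longleftrightarrow> ssum ss (map num xss) = 0"
proof -
  let ?bs = "replicate R (1 :: nat)" and ?S = "ssum ss (map num xss)"
  have 0: "num ?bs = 0" by (simp add: num_eq_0_iff)
  obtain q where q: "int (num (accs ?bs ss xss)) = ?S + 2 ^ R * q"
    using num_accs[of xss ?bs ss] assms(1) 0 by auto
  have S: "\<bar>?S\<bar> < 2 ^ R"
    using abs_ssum_le[of ss "map num xss"] assms(2)
    by (metis le_less_trans of_nat_less_iff of_nat_numeral of_nat_power)
  have n: "int (num (accs ?bs ss xss)) < 2 ^ R"
    using num_less[of "accs ?bs ss xss"] by (metis length_accs length_replicate of_nat_less_iff
        of_nat_numeral of_nat_power)
  have "num (accs ?bs ss xss) = 0 \<longleftrightarrow> ?S = 0"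
  proof
    assume "num (accs ?bs ss xss) = 0"
    then have "2 ^ R dvd ?S" using q by (metis add.commute dvd_add_left_iff dvd_triv_left dvd_0_right of_nat_0)
    then show "?S = 0" using S by (metis dvd_imp_le_int not_less power_strict_increasing_iff
        abs_numeral power_abs)
  next
    assume "?S = 0"
    then have "2 ^ R dvd int (num (accs ?bs ss xss))" using q by simp
    then show "num (accs ?bs ss xss) = 0" using n by (metis zdvd_not_zless of_nat_0_less_iff gr0I)
  qed
  then show ?thesis by (simp add: num_eq_0_iff)
qed

section \<open>From PARTITION to AMCCR\<close>

text \<open>The reduction on the level of numbers. It is used with \<open>n = K + length as\<close>,
  which gives the last pair the exponent \<open>K\<close>.\<close>

fun nums :: "nat \<Rightarrow> nat list \<Rightarrow> nat list" where
  "nums n [] = [2 ^ n, 2 ^ n]"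
| "nums n (a # as) = (2 ^ n + a) # 2 ^ n # nums (n - 1) as"

section \<open>Encoding, order and size of the constructed numbers\<close>

lemma length_nums [simp]: "length (nums n as) = 2 * (length as + 1)"
  by (induction n as rule: nums.induct) auto

lemma nums_pos: "\<forall>v\<in>set (nums n as). 0 < v"
  by (induction n as rule: nums.induct) auto

text \<open>Bit \<open>n\<close> lies above all bits of \<open>a\<close>, so no carry
  occurs.\<close>

lemma bin_power2_add:
  "length (bin a) \<le> n \<Longrightarrow> bin (2 ^ n + a) = bin a @ replicate (n - length (bin a)) 1 @ [2]"
proof (induction n arbitrary: a)
  case 0
  then have "a = 0" by (subst (asm) bin.simps) (auto split: if_splits)
  then show ?case by (simp add: bin.simps)
next
  case (Suc n)
  have *: "bin (2 ^ Suc n + a) = (if even a then 1 else 2) # bin (2 ^ n + a div 2)"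
    by (subst bin.simps) simp
  show ?case
  proof (cases "a = 0")
    case True
    then show ?thesis using Suc.IH[of 0] * by (simp add: bin.simps[of 0])
  next
    case False
    then have "bin a = (if even a then 1 else 2) # bin (a div 2)" by (subst bin.simps) simp
    then show ?thesis using Suc * by simp
  qed
qed

lemma enc_rat_of_nat: "enc_rat (of_nat n) = bin n @ [slash, bit1]"
proof -
  have "bin 1 = [2]" by (simp add: bin.simps)
  then show ?thesis
    by (simp add: enc_rat_def quotient_of_int[of "int n", simplified])
qed

lemma enc_list_simps [simp]:
  "enc_list f [] = []" "enc_list f (x # xs) = f x @ comma # enc_list f xs"
  by (simp_all add: enc_list_def)

lemma item_eq:
  "length (bin a) \<le> n \<Longrightarrow>
    item n (bin a) = enc_list enc_rat [of_nat (2 ^ n + a), of_nat (2 ^ n)]"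
  using bin_power2_add[of a n] bin_power2_add[of 0 n] bin.simps[of 0]
  unfolding enc_list_simps enc_rat_of_nat by (simp add: item_def)

lemma out_eq:
  "\<forall>a\<in>set as. length (bin a) + length as \<le> n \<Longrightarrow>
    out n (map bin as) = enc_list enc_rat (map of_nat (nums n as))"
proof (induction n as rule: nums.induct)
  case (1 n)
  then show ?case using item_eq[of 0 n] by (simp add: bin.simps[of 0])
next
  case (2 n a as)
  have "\<forall>a\<in>set as. length (bin a) + length as \<le> n - 1" using 2(2) by fastforce
  then show ?case using 2 item_eq[of a n] by simp
qed

lemma nums_less: "\<forall>a\<in>set as. a < 2 ^ K \<Longrightarrow> v \<in> set (nums (K + length as) as) \<Longrightarrow> v < 2 ^ (K + length as + 1)"
proof (induction as arbitrary: v)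
  case (Cons a as)
  have "(2::nat) ^ K \<le> 2 ^ (K + length as)" by (simp add: power_increasing)
  moreover have "a < 2 ^ K" using Cons.prems(1) by simp
  ultimately have "a < 2 ^ (K + length as)" by linarith
  moreover have "v < 2 ^ (K + length as + 1)" if "v \<in> set (nums (K + length as) as)"
    using Cons.IH[OF _ that] Cons.prems(1) by simp
  ultimately show ?case using Cons.prems(2) by auto
qed auto

text \<open>A later entry is at most a smaller power of 2 plus some \<open>a < 2 ^ K\<close>, and
  this sum never reaches the next power of 2, with which the preceding pair ends.\<close>

lemma sorted_nums: "\<forall>a\<in>set as. a < 2 ^ K \<Longrightarrow> sorted_wrt (\<ge>) (nums (K + length as) as)"
proof (induction as)
  case (Cons a as)
  have "v \<le> 2 ^ (K + length (a # as))" if "v \<in> set (nums (K + length as) as)" for v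
    using nums_less[of as K v] that Cons.prems by simp
  then show ?case using Cons by (fastforce intro: trans_le_add1)
qed simp

text \<open>A geometric sum of the doubled powers; \<open>2 * 2 ^ K\<close> stands on the left to
  avoid truncated subtraction.\<close>

lemma sum_nums: "sum_list (nums (K + length as) as) + 2 * 2 ^ K = 4 * 2 ^ (K + length as) + sum_list as"
  by (induction as) (auto simp: algebra_simps)


text \<open>
  The sum \<open>t\<close> of the signed small parts of the preceding pairs is too small to compensate for a
  pair with equal signs.
\<close>

lemma nums_pairs_opposite:
  assumes "length ps = 2 * (length as + 1)"
    and "\<bar>t\<bar> + int (sum_list as) < 2 ^ K"
    and "ssum ps (nums (K + length as) as) + t = 0"
  shows "(\<forall>i\<le>length as. ps ! (2 * i) \<noteq> ps ! (2 * i + 1)) \<and>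
    ssum (map (\<lambda>i. ps ! (2 * i)) [0..<length as]) as + t = 0"
  using assms
proof (induction as arbitrary: ps t)
  case Nil
  then obtain p p' where ps: "ps = [p, p']"
    by (cases ps; cases "tl ps") auto
  have "(0::int) < 2 ^ K" by simp
  then show ?case using Nil(2,3) ps by (auto split: if_splits)
next
  case (Cons a as)
  obtain p p' ps' where ps: "ps = p # p' # ps'"
    using Cons.prems(1) by (cases ps; cases "tl ps") auto
  let ?v = "nums (K + length as) as" and ?n = "K + length as"
  let ?t = "t + (if p then int a else - int a)"
  have eq: "(if p then 2 * 2 ^ ?n + int a else - (2 * 2 ^ ?n + int a)) +
      (if p' then 2 * 2 ^ ?n else - (2 * 2 ^ ?n)) + ssum ps' ?v + t = 0"
    using Cons.prems(3) ps by (simp split: if_splits)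
  have bound: "\<bar>ssum ps' ?v\<bar> + 2 * 2 ^ K \<le> 4 * 2 ^ ?n + int (sum_list as)"
    using abs_ssum_le[of ps' ?v] arg_cong[OF sum_nums[of K as], of int] by simp
  have t: "\<bar>t\<bar> + int a + int (sum_list as) < 2 ^ K" using Cons.prems(2) by simp
  have opp: "p \<noteq> p'"
  proof
    assume "p = p'"
    \<comment> \<open>The current exponent is \<open>?n + 1\<close>, so equal signs contribute at
      least \<open>4 * 2 ^ ?n + int a\<close> in absolute value. The later pairs fall short of
      \<open>4 * 2 ^ ?n\<close> by too much for \<open>t\<close> to compensate.\<close>
    then have "4 * 2 ^ ?n + int a \<le> \<bar>ssum ps' ?v\<bar> + \<bar>t\<bar>" using eq by (auto split: if_splits)
    then show False using bound t by linarith
  qed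
  \<comment> \<open>With opposite signs the powers cancel, and the signed \<open>a\<close> is moved
    into \<open>t\<close>.\<close>
  then have "ssum ps' ?v + ?t = 0" using eq by (auto split: if_splits)
  moreover have "\<bar>?t\<bar> + int (sum_list as) < 2 ^ K" using t by auto
  ultimately have IH: "\<forall>i\<le>length as. ps' ! (2 * i) \<noteq> ps' ! (2 * i + 1)"
      "ssum (map (\<lambda>i. ps' ! (2 * i)) [0..<length as]) as + ?t = 0"
    using Cons.IH[of ps' ?t] Cons.prems(1) ps by simp_all
  have "ps ! (2 * i) \<noteq> ps ! (2 * i + 1)" if "i \<le> length (a # as)" for i
    using that IH(1) opp ps by (cases i) auto
  moreover have "ssum (map (\<lambda>i. ps ! (2 * i)) [0..<length (a # as)]) (a # as) + t = 0"
    using IH(2) ps by (simp add: map_upt_Suc del: upt_Suc)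
  ultimately show ?case by blast
qed

section \<open>Signings, partitions and maximizers\<close>

lemma ssum_nums:
  "length ss = length as \<Longrightarrow>
    ssum (concat (map (\<lambda>s. [s, \<not> s]) ss) @ [True, False]) (nums n as) = ssum ss as"
  by (induction ss as arbitrary: n rule: list_induct2) auto

lemma has_partition_iff: "has_partition as \<longleftrightarrow> (\<exists>ss. length ss = length as \<and> ssum ss as = 0)"
proof -
  have split: "(\<Sum>i<length as. if i \<in> J then int (as ! i) else - int (as ! i)) = 0 \<longleftrightarrow>
      (\<Sum>i\<in>J. as ! i) = (\<Sum>i\<in>{..<length as} - J. as ! i)" if "J \<subseteq> {..<length as}" for J
  proof -
    have "{..<length as} \<inter> J = J" "{..<length as} \<inter> - J = {..<length as} - J" using that by auto
    then have "(\<Sum>i<length as. if i \<in> J then int (as ! i) else - int (as ! i)) =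
        int (\<Sum>i\<in>J. as ! i) - int (\<Sum>i\<in>{..<length as} - J. as ! i)"
      by (simp add: sum.If_cases sum_negf)
    then show ?thesis by linarith
  qed
  show ?thesis
  proof
    assume "has_partition as"
    then obtain J where J: "J \<subseteq> {..<length as}" "(\<Sum>i\<in>J. as ! i) = (\<Sum>i\<in>{..<length as} - J. as ! i)"
      by (auto simp: has_partition_def)
    let ?ss = "map (\<lambda>i. i \<in> J) [0..<length as]"
    have "ssum ?ss as = 0" using split[OF J(1)] J(2) by (simp add: ssum_eq_sum)
    then show "\<exists>ss. length ss = length as \<and> ssum ss as = 0" by (intro exI[of _ ?ss]) simp
  next
    assume "\<exists>ss. length ss = length as \<and> ssum ss as = 0"
    then obtain ss where ss: "length ss = length as" "ssum ss as = 0" by blast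
    let ?J = "{i. i < length as \<and> ss ! i}"
    have "(\<Sum>i<length as. if i \<in> ?J then int (as ! i) else - int (as ! i)) = ssum ss as"
      unfolding ssum_eq_sum[OF ss(1)] by (intro sum.cong) auto
    then have "(\<Sum>i\<in>?J. as ! i) = (\<Sum>i\<in>{..<length as} - ?J. as ! i)"
      using split[of ?J] ss(2) by auto
    then show "has_partition as" unfolding has_partition_def by (intro exI[of _ ?J]) auto
  qed
qed

text \<open>The given signing \<open>ps0\<close> provides a feasible point at which every term of
  \<open>G\<close> attains its upper bound. The maximizer behind the answer must then attain each
  bound too, so it has absolute value \<open>b i\<close> everywhere, even at the exceptional index,
  and its signs form \<open>ps\<close>.\<close>

lemma AMCCR_solution_signing:
  assumes pos: "\<forall>v\<in>set vs. 0 < v"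
    and ps0: "length ps0 = length vs" "ssum ps0 vs = 0"
    and sol: "AMCCR_solution (map of_nat vs) (Jp, Jm)"
  obtains ps where "length ps = length vs" "ssum ps vs = 0"
    "\<forall>i\<in>Jp. ps ! i" "\<forall>i\<in>Jm. \<not> ps ! i" "\<exists>h. {..<length vs} - (Jp \<union> Jm) = {h}"
proof -
  define k where "k = length vs"
  define b where "b i = real_of_rat (map of_nat vs ! i)" for i
  have b: "b i = real (vs ! i)" "0 < b i" if "i < k" for i
    using that pos by (auto simp: b_def k_def)
  have sub: "Jp \<subseteq> {..<k}" "Jm \<subseteq> {..<k}"
    using sol by (auto simp: AMCCR_solution_def k_def Let_def)
  obtain x h where x: "maximizer k b x" "\<forall>i\<in>Jp. x i = b i" "\<forall>i\<in>Jm. x i = - b i"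
      and h: "{..<k} - (Jp \<union> Jm) = {h}"
    using sol unfolding AMCCR_solution_def b_def k_def Let_def by auto
  have "0 < k" using h by (cases k) auto
  \<comment> \<open>The feasible point given by \<open>ps0\<close>; \<open>restrict\<close> makes it
    extensional, as membership in \<open>T_f\<close> demands.\<close>
  define y where "y = restrict (\<lambda>i. if ps0 ! i then b i else - b i) {..<k}"
  have "real_of_int (ssum ps0 vs) = (\<Sum>i<k. y i)"
    unfolding ssum_eq_sum[OF ps0(1)] of_int_sum k_def[symmetric]
    by (intro sum.cong) (auto simp: y_def b)
  then have y: "y \<in> T_f k b" using ps0(2) b(2) by (auto simp: T_f_def y_def less_imp_le)
  let ?f = "\<lambda>z i. sqrt ((alpha (b i))\<^sup>2 + (z i)\<^sup>2)"
  have al: "(alpha (b i))\<^sup>2 = 1 + 2 * b i" if "i < k" for i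
    using b(2)[OF that] by (simp add: alpha_def)
  have fy: "?f y i = 1 + b i" if "i < k" for i
  proof -
    have "(alpha (b i))\<^sup>2 + (y i)\<^sup>2 = (1 + b i)\<^sup>2"
      unfolding al[OF that] using that by (auto simp: y_def power2_eq_square algebra_simps)
    then show ?thesis using b(2)[OF that] by simp
  qed
  have x01: "x \<in> T_f k b" using x(1) by (simp add: maximizer_def)
  have fx: "?f x i \<le> ?f y i" if "i < k" for i
  proof -
    have "\<bar>x i\<bar> \<le> b i" using x01 that by (fastforce simp: T_f_def PiE_def Pi_def)
    then have "(x i)\<^sup>2 \<le> (b i)\<^sup>2" by (rule abs_le_square_iff[THEN iffD1, OF order.trans]) simp
    moreover have "(y i)\<^sup>2 = (b i)\<^sup>2" using that by (simp add: y_def)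
    ultimately show ?thesis by simp
  qed
  have le: "(\<Sum>i<k. ?f y i) \<le> (\<Sum>i<k. ?f x i)"
    using x(1) y \<open>0 < k\<close> by (auto simp: maximizer_def G_def divide_le_cancel)
  have "(\<Sum>i<k. ?f x i) = (\<Sum>i<k. ?f y i)"
    by (rule antisym[OF sum_mono le]) (use fx in simp)
  \<comment> \<open>Equal sums and termwise inequalities force equality in every term.\<close>
  then have feq: "?f x i = ?f y i" if "i < k" for i
    using sum_mono_inv[of "?f x" "{..<k}" "?f y"] fx that by auto
  have xb: "\<bar>x i\<bar> = b i" if "i < k" for i
  proof -
    have "(x i)\<^sup>2 = (b i)\<^sup>2" using feq[OF that] that by (simp add: y_def split: if_splits)
    then show ?thesis using b(2)[OF that] by (simp add: power2_eq_iff) (auto simp: abs_if)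
  qed
  let ?ps = "map (\<lambda>i. 0 < x i) [0..<k]"
  have "real_of_int (ssum ?ps vs) = (\<Sum>i<k. x i)"
    using xb by (simp add: ssum_eq_sum k_def of_int_sum) (intro sum.cong refl, force simp: k_def b)
  then have "ssum ?ps vs = 0" using x01 by (simp add: T_f_def)
  moreover have "\<forall>i\<in>Jp. ?ps ! i" using x(2) sub(1) b(2) by (auto simp: subset_iff)
  moreover have "\<forall>i\<in>Jm. \<not> ?ps ! i" using x(3) sub(2) b(2) by (force simp: subset_iff)
  moreover have "\<exists>h. {..<length vs} - (Jp \<union> Jm) = {h}" using h by (simp add: k_def)
  ultimately show thesis using that[of ?ps] by (simp add: k_def)
qed


lemma nth_enc_index_set: "i < k \<Longrightarrow> enc_index_set k J ! i = enc_bool (i \<in> J)"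
  by (simp add: enc_index_set_def)

text \<open>If the signed sum vanishes, its signs are a partition, whatever the answer was.
  Conversely, if a partition exists, every correct answer comes from a signing of sum 0, whose pairs
  have opposite signs.\<close>

lemma ssum_signs_eq_0_iff:
  assumes sum: "sum_list as < 2 ^ K" and n: "n = K + length as"
    and sol: "AMCCR_solution (map of_nat (nums n as)) (Jp, Jm)"
    and k: "k = 2 * (length as + 1)"
  shows "ssum (signs (length as) (enc_index_set k Jp) (enc_index_set k Jm)) as = 0 \<longleftrightarrow>
    has_partition as"
proof
  let ?ss = "signs (length as) (enc_index_set k Jp) (enc_index_set k Jm)"
  have ss: "?ss = map (\<lambda>i. 2 * i \<in> Jp \<or> 2 * i + 1 \<in> Jm) [0..<length as]"
    by (auto simp: signs_def enc_bool_def k nth_enc_index_set simp del: upt_Suc)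
  {
    assume "ssum ?ss as = 0"
    moreover have "length ?ss = length as" by (simp add: ss)
    ultimately show "has_partition as" using has_partition_iff by blast
  next
    assume "has_partition as"
    then obtain qs where qs: "length qs = length as" "ssum qs as = 0" using has_partition_iff by blast
    let ?qs = "concat (map (\<lambda>s. [s, \<not> s]) qs) @ [True, False]"
    have len: "length (concat (map (\<lambda>s. [s, \<not> s]) qs)) = 2 * length qs"
      by (induction qs) auto
    have "length ?qs = length (nums n as)" using qs(1) len by simp
    moreover have "ssum ?qs (nums n as) = 0" using ssum_nums[OF qs(1)] qs(2) by simp
    ultimately obtain ps h where ps: "length ps = length (nums n as)" "ssum ps (nums n as) = 0"
        "\<forall>i\<in>Jp. ps ! i" "\<forall>i\<in>Jm. \<not> ps ! i" and h: "{..<k} - (Jp \<union> Jm) = {h}"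
      by (rule AMCCR_solution_signing[OF nums_pos _ _ sol]) (auto simp: k)
    have opp: "\<forall>i\<le>length as. ps ! (2 * i) \<noteq> ps ! (2 * i + 1)"
      and eq: "ssum (map (\<lambda>i. ps ! (2 * i)) [0..<length as]) as = 0"
      using nums_pairs_opposite[of ps as 0 K] ps sum n by (simp_all flip: of_nat_less_iff)
    have J: "j \<in> Jp \<union> Jm" if "j < k" "j \<noteq> h" for j using h that by blast
    have "(2 * i \<in> Jp \<or> 2 * i + 1 \<in> Jm) = ps ! (2 * i)" if i: "i < length as" for i
    proof -
      have "ps ! (2 * i) \<noteq> ps ! (2 * i + 1)" using opp i by simp
      \<comment> \<open>At most one element of a pair is the exceptional index \<open>h\<close>; the
        other one lies in an index set and determines the sign of the pair.\<close>
      moreover have "2 * i \<in> Jp \<union> Jm \<or> 2 * i + 1 \<in> Jp \<union> Jm"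
        using J[of "2 * i"] J[of "2 * i + 1"] i k by (cases "2 * i = h") auto
      ultimately show ?thesis using ps(3,4) by blast
    qed
    then have "?ss = map (\<lambda>i. ps ! (2 * i)) [0..<length as]" unfolding ss by simp
    then show "ssum ?ss as = 0" using eq by simp
  }
qed

section \<open>Running time\<close>

lemma poly_nat_mono: "x \<le> y \<Longrightarrow> poly p x \<le> poly p y" for p :: "nat poly"
  by (induction p) (auto intro!: add_mono mult_mono)

lemma set_bin: "set (bin n) \<subseteq> {1, 2}"
proof (induction n rule: bin.induct)
  case (1 n)
  then show ?case by (subst bin.simps) auto
qed

lemma length_le_commas: "length xss \<le> length (commas xss)"
  by (induction xss) auto

lemma length_commas_ge: "xs \<in> set xss \<Longrightarrow> length xs + length xss \<le> length (commas xss)"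
proof (induction xss)
  case (Cons ys xss)
  then show ?case using length_le_commas[of xss] by auto
qed simp

lemma enc_list_bin: "enc_list bin as = commas (map bin as)"
  by (induction as) auto

text \<open>The comma after each number supplies the extra bit that an addition may need.\<close>

lemma sum_list_less: "sum_list as < 2 ^ length (enc_list bin as)"
proof (induction as)
  case (Cons a as)
  let ?l = "length (bin a)" and ?m = "length (enc_list bin as)"
  have "a < 2 ^ ?l" using num_less[of "bin a"] by simp
  moreover have "(2::nat) ^ ?l \<le> 2 ^ (?l + ?m)" "(2::nat) ^ ?m \<le> 2 ^ (?l + ?m)"
    by (simp_all add: power_increasing)
  ultimately have "a + sum_list as < 2 * 2 ^ (?l + ?m)" using Cons.IH by linarith
  then show ?case by simp
qed simp

lemma length_out:
  "\<forall>xs\<in>set xss. length xs + length xss \<le> n \<Longrightarrow> length (out n xss) \<le> (length xss + 1) * (2 * n + 8)"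
proof (induction n xss rule: out.induct)
  case (2 n xs xss)
  have "length (out (n - 1) xss) \<le> (length xss + 1) * (2 * (n - 1) + 8)"
    using 2 by fastforce
  also have "\<dots> \<le> (length xss + 1) * (2 * n + 8)" by (intro mult_le_mono) auto
  finally show ?case using 2(2) length_item[of xs n] by simp
qed (simp add: length_item)

section \<open>Correctness of the reduction with its polynomial time bound\<close>

lemma PARTITION_by_AMCCR:
  assumes M: "turing_machine M"
    and solves: "\<forall>x\<in>AMCCR_instances. \<exists>y. AMCCR_solution x y \<and>
      halts_within M (enc_list enc_rat x) (poly p (length (enc_list enc_rat x))) (enc_AMCCR_answer x y)"
    and w: "w = enc_list bin as"
  shows "halts_within (red M) w (poly (pcompose p [:8, 12, 4:] + smult 10 [:8, 12, 4:]) (length w))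
    [enc_bool (has_partition as)]"
proof -
  define xss where "xss = map bin as"
  define N where "N = length w"
  define n where "n = 2 * N"
  \<comment> \<open>\<open>?Q\<close> bounds both the length of the AMCCR instance and the cost of
    each loop over the numbers. Expanded as a polynomial in \<open>N\<close> it is
    \<open>[:8, 12, 4:]\<close>.\<close>
  let ?k = "length as" and ?v = "out n xss" and ?Q = "(N + 1) * (4 * N + 8)"
  have w': "w = commas xss" by (simp add: w xss_def enc_list_bin)
  have k: "length xss = ?k" by (simp add: xss_def)
  have kN: "?k \<le> N" using length_le_commas[of xss] by (simp add: N_def w' k)
  have "length xs + length xss \<le> n" if "xs \<in> set xss" for xs
    using length_commas_ge[OF that] by (simp add: n_def N_def w')
  moreover have "set xs \<subseteq> {1, 2}" if "xs \<in> set xss" for xs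
    using that set_bin by (auto simp: xss_def)
  ultimately have xss: "\<forall>xs\<in>set xss. set xs \<subseteq> {1, 2} \<and> length xs + length xss \<le> n"
    by blast
  \<comment> \<open>\<open>K\<close> is the exponent of the last pair and also the length of the
    accumulator. Since \<open>N \<le> K\<close>, the sum of the input numbers is below
    \<open>2 ^ K\<close>, as both the pairing argument and the test modulo \<open>2 ^ K\<close>
    require.\<close>
  define K where "K = n - ?k"
  have nK: "n = K + ?k" and NK: "N \<le> K" using kN by (simp_all add: K_def n_def)
  have "(2::nat) ^ N \<le> 2 ^ K" using NK by (simp add: power_increasing)
  then have sum: "sum_list as < 2 ^ K"
    using sum_list_less[of as] unfolding N_def w by linarith
  let ?x = "map of_nat (nums n as) :: rat list"
  have v: "?v = enc_list enc_rat ?x"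
    unfolding xss_def by (rule out_eq) (use xss in \<open>auto simp: xss_def\<close>)
  have "\<forall>a\<in>set as. a < 2 ^ K" using sum by (auto dest: member_le_sum_list)
  then have "sorted_wrt (\<ge>) ?x"
    using sorted_nums[of as K] nK by (simp add: sorted_wrt_map)
  then have "?x \<in> AMCCR_instances" by (auto simp: AMCCR_instances_def)
  then obtain y where "AMCCR_solution ?x y"
      "halts_within M ?v (poly p (length ?v)) (enc_AMCCR_answer ?x y)"
    unfolding v using solves by blast
  then obtain Jp Jm where sol: "AMCCR_solution ?x (Jp, Jm)"
    and run: "halts_within M ?v (poly p (length ?v)) (enc_AMCCR_answer ?x (Jp, Jm))"
    by (cases y) simp
  let ?l = "2 * (?k + 1)"
  let ?ps = "enc_index_set ?l Jp" and ?ms = "enc_index_set ?l Jm"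
  have len: "length ?ps = ?l" "length ?ms = ?l" by (simp_all add: enc_index_set_def)
  have run': "halts_within M ?v (poly p (length ?v)) (?ps @ comma # ?ms)"
    using run by (simp add: enc_AMCCR_answer_def)
  have lv: "length ?v \<le> (?k + 1) * (2 * n + 8)"
    using length_out[of xss n] xss by (simp add: xss_def)
  have kQ: "(?k + 1) * (2 * n + 8) \<le> ?Q" using kN by (intro mult_le_mono) (auto simp: n_def)
  have kQ': "?k * (2 * n + 4) \<le> ?Q" using kN by (intro mult_le_mono) (auto simp: n_def)
  have Q: "12 * N + 8 \<le> ?Q" by (simp add: algebra_simps)
  have poly: "poly (pcompose p [:8, 12, 4:] + smult 10 [:8, 12, 4:]) N = poly p ?Q + 10 * ?Q"
    by (simp add: poly_pcompose algebra_simps)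
  have pQ: "poly p (length ?v) \<le> poly p ?Q" using lv kQ by (intro poly_nat_mono) linarith
  have "3 * N + (?k + 1) * (2 * n + 8) + length ?v + poly p (length ?v) + 2 * ?l
      + ?k * (2 * n + 4) + n + 10 \<le> poly p ?Q + 10 * ?Q"
  proof -
    \<comment> \<open>Products and polynomial values are replaced by variables, which leaves linear
      arithmetic.\<close>
    have "3 * N + a + L + t + 2 * (2 * (l + 1)) + c + 2 * N + 10 \<le> u + 10 * q"
      if "L \<le> a" "a \<le> q" "c \<le> q" "t \<le> u" "12 * N + 8 \<le> q" "l \<le> N" for a L t c u q l :: nat
    proof -
      have "9 * N + 14 \<le> 7 * q" using that(5) by simp
      moreover have "4 * l + 4 \<le> 4 * N + 4" using that(6) by simp
      moreover have "a + L + c \<le> 3 * q" using that(1-3) by simp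
      ultimately show ?thesis using that(4) by simp
    qed
    from this[OF lv kQ kQ' pQ Q kN] show ?thesis by (simp only: n_def)
  qed
  then have "halts_within (red M) w (poly p ?Q + 10 * ?Q)
      [enc_bool (2 \<notin> set (accs (replicate (n - length xss) 1) (signs (length xss) ?ps ?ms) xss))]"
    using kN
    by (intro halts_within_red[OF M xss w' _ run'])
       (auto simp: xss_def n_def N_def len enc_index_set_def enc_bool_def)
  moreover have "2 \<notin> set (accs (replicate (n - length xss) 1) (signs (length xss) ?ps ?ms) xss) \<longleftrightarrow>
      has_partition as"
  proof -
    have "map num xss = as" by (simp add: xss_def comp_def)
    moreover have "length xs \<le> K" if "xs \<in> set xss" for xs
    proof -
      have "length xs + length xss \<le> n" using xss that by blast
      then show ?thesis unfolding K_def k by linarith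
    qed
    ultimately have "2 \<notin> set (accs (replicate K 1) (signs ?k ?ps ?ms) xss) \<longleftrightarrow>
        ssum (signs ?k ?ps ?ms) as = 0"
      using accs_eq_0_iff[of xss K "signs ?k ?ps ?ms"] sum by simp
    then show ?thesis
      using ssum_signs_eq_0_iff[OF sum nK sol refl] by (simp add: K_def xss_def)
  qed
  ultimately show ?thesis unfolding N_def[symmetric] poly by simp
qed

theorem theorem3p1:
  assumes "poly_time_solvable AMCCR_instances (enc_list enc_rat) AMCCR_solution enc_AMCCR_answer"
  shows "poly_time_solvable PARTITION_instances (enc_list bin) PARTITION_solution enc_PARTITION_answer"
proof -
  obtain M and p :: "nat poly" where M: "turing_machine M"
    and solves: "\<forall>x\<in>AMCCR_instances. \<exists>y. AMCCR_solution x y \<and>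
      halts_within M (enc_list enc_rat x) (poly p (length (enc_list enc_rat x))) (enc_AMCCR_answer x y)"
    using assms unfolding poly_time_solvable_def by blast
  show ?thesis
    unfolding poly_time_solvable_def PARTITION_solution_def enc_PARTITION_answer_def
    using turing_machine_red[OF M] PARTITION_by_AMCCR[OF M solves refl] by blast
qed

end
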